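(* Let $G=(V,E)$ be a finite simple connected graph with disjoint cycles, and let $h\in\mathcal S(G)$ be generic. Then for every $k$, the only simple critical points of $\lambda_k:\mathcal M_h\to\mathbb R$ are the signings of $h$, i.e. the elements of $\mathcal S_h^{\pm}$ (defined in the context).
   Context: A graph has disjoint cycles if no two distinct simple cycles share a vertex. Graphs and matrices. A matrix $h$ indexed by $V$ is supported on $G$ if for $r\ne s$, $h_{rs}\neq0\Rightarrow (rs)\in E$; strictly supported if for $r\neq s$, $h_{rs}\ne0\iff(rs)\in E$. $\mathcal H(G)$, $\mathcal S(G)$, $\mathcal A(G)$ are the spaces of complex Hermitian, real symmetric, real antisymmetric matrices supported on $G$. Eigenvalues of a Hermitian matrix are ordered $\lambda_1\le\lambda_2\le\dots$. For an induced subgraph $G_J$ on a vertex set $J$, $h|G_J$ is the principal submatrix with indices in $J$. Magnetic torus. For $h\in\mathcal S(G)$ strictly supported on $G$ and $\alpha\in\mathcal A(G)$ let $(h_\alpha)_{rs}=e^{i\alpha_{rs}}h_{rs}$. Matrices $h',h''\in\mathcal H(G)$ are gauge equivalent if $h''=e^{i\theta}h'e^{-i\theta}$ for some $\theta\in\mathbb R^V$, with $e^{i\theta}=\operatorname{diag}(e^{i\theta_1},\dots,e^{i\theta_n})$. $\mathcal M_h$ is the set of gauge equivalence classes $[h_\alpha]$, $\alpha\in\mathcal A(G)$. It is a torus of dimension $|E|-|V|+1$: with $(d\theta)_{rs}=\theta_r-\theta_s$ for $(rs)\in E$, it is the quotient of $\mathcal A(G)$ by $d\mathbb R^V$ and by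 matrices with entries in $2\pi\mathbb Z$. The eigenvalue $\lambda_k$ descends to a function $\lambda_k:\mathcal M_h\to\mathbb R$, smooth near points where it is a simple eigenvalue. A simple critical point of $\lambda_k$ is a critical point $[h_\alpha]$ of this function at which $\lambda_k(h_\alpha)$ is a simple eigenvalue. Signings. A signing of a real symmetric matrix $h$ is a real symmetric $h'$ with $h'_{rr}=h_{rr}$ and $h'_{rs}=\pm h_{rs}$ for $r\neq s$. $\mathcal S_h^{\pm}=\{[h']\in\mathcal M_h: h'\text{ is a signing of }h\}$. Genericity. $h\in\mathcal S(G)$ is generic if (i) $h$ is strictly supported on $G$; (ii) for any induced subgraph $G_J$ of $G$ (including $G_J=G$) and any signing $h'$ of $h|G_J$, all eigenvalues of $h'$ are simple, and every eigenvector of $h'$ is nowhere vanishing on exactly one connected component of $G_J$. *)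

theory Defs
  imports "HOL-Analysis.Analysis" "HOL-Computational_Algebra.Polynomial"
begin

text \<open>
  The vertex set of a graph is a finite type \<open>'n\<close>; the edge set is a symmetric irreflexive
  relation on it.
\<close>

definition simple_graph :: "'n rel \<Rightarrow> bool" where
  "simple_graph E \<longleftrightarrow> sym E \<and> irrefl E"

definition connected_graph :: "'n rel \<Rightarrow> bool" where
  "connected_graph E \<longleftrightarrow> (\<forall>r s. (r, s) \<in> E\<^sup>*)"

definition components :: "'n rel \<Rightarrow> 'n set \<Rightarrow> 'n set set" where
  "components E J = J // (Restr E J)\<^sup>*"

text \<open>
  A simple cycle is listed from some starting vertex in some direction, so the same cycle has
  several listings; as a subgraph it is determined by its set of (unoriented) edges.
\<close>

definition simple_cycle :: "'n rel \<Rightarrow> 'n list \<Rightarrow> bool" where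
  "simple_cycle E c \<longleftrightarrow>
     3 \<le> length c \<and> distinct c \<and>
     (\<forall>i<length c. (c ! i, c ! (Suc i mod length c)) \<in> E)"

definition cycle_edges :: "'n list \<Rightarrow> 'n set set" where
  "cycle_edges c = (\<lambda>i. {c ! i, c ! (Suc i mod length c)}) ` {..<length c}"

definition disjoint_cycles :: "'n rel \<Rightarrow> bool" where
  "disjoint_cycles E \<longleftrightarrow>
     (\<forall>c d. simple_cycle E c \<and> simple_cycle E d \<and> cycle_edges c \<noteq> cycle_edges d
        \<longrightarrow> set c \<inter> set d = {})"

definition supported :: "'n rel \<Rightarrow> 'a::zero ^ 'n ^ 'n \<Rightarrow> bool" where
  "supported E h \<longleftrightarrow> (\<forall>r s. r \<noteq> s \<longrightarrow> h $ r $ s \<noteq> 0 \<longrightarrow> (r, s) \<in> E)"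

definition strictly_supported :: "'n rel \<Rightarrow> 'a::zero ^ 'n ^ 'n \<Rightarrow> bool" where
  "strictly_supported E h \<longleftrightarrow> (\<forall>r s. r \<noteq> s \<longrightarrow> (h $ r $ s \<noteq> 0 \<longleftrightarrow> (r, s) \<in> E))"

definition Herm :: "'n rel \<Rightarrow> (complex ^ 'n ^ 'n) set" where
  "Herm E = {h. (\<forall>r s. h $ s $ r = cnj (h $ r $ s)) \<and> supported E h}"

definition Symm :: "'n rel \<Rightarrow> (real ^ 'n ^ 'n) set" where
  "Symm E = {h. transpose h = h \<and> supported E h}"

definition Asym :: "'n rel \<Rightarrow> (real ^ 'n ^ 'n) set" where
  "Asym E = {\<alpha>. transpose \<alpha> = - \<alpha> \<and> supported E \<alpha>}"

definition cmat :: "real ^ 'n ^ 'n \<Rightarrow> complex ^ 'n ^ 'n" where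
  "cmat h = (\<chi> r s. complex_of_real (h $ r $ s))"

text \<open>
  A matrix indexed by a vertex set \<open>J\<close> is encoded as a matrix on the whole vertex type of which
  only the entries with both indices in \<open>J\<close> are used, and a vector in \<open>\<complex>\<^sup>J\<close> as a vector that
  vanishes off \<open>J\<close>. \<open>det_on J\<close> is the Leibniz formula for the determinant over the index set
  \<open>J\<close>; for \<open>J = UNIV\<close> it is the library's \<open>det\<close>.
\<close>

definition det_on :: "'n::finite set \<Rightarrow> 'a::comm_ring_1 ^ 'n ^ 'n \<Rightarrow> 'a" where
  "det_on J A = (\<Sum>p | p permutes J. of_int (sign p) * (\<Prod>r\<in>J. A $ r $ p r))"

lemma det_on_UNIV: "det_on UNIV A = det A"
  by (simp add: det_on_def det_def)

definition charpoly_on :: "'n::finite set \<Rightarrow> complex ^ 'n ^ 'n \<Rightarrow> complex poly" where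
  "charpoly_on J A = det_on J (\<chi> r s. (if r = s then [:0, 1:] else 0) - [:A $ r $ s:])"

abbreviation charpoly :: "complex ^ 'n::finite ^ 'n \<Rightarrow> complex poly" where
  "charpoly \<equiv> charpoly_on UNIV"

definition eigenvalue_on :: "'n::finite set \<Rightarrow> complex ^ 'n ^ 'n \<Rightarrow> complex \<Rightarrow> bool" where
  "eigenvalue_on J A \<mu> \<longleftrightarrow> poly (charpoly_on J A) \<mu> = 0"

definition simple_eigenvalue_on :: "'n::finite set \<Rightarrow> complex ^ 'n ^ 'n \<Rightarrow> complex \<Rightarrow> bool" where
  "simple_eigenvalue_on J A \<mu> \<longleftrightarrow> order \<mu> (charpoly_on J A) = 1"

definition eigenvector_on :: "'n::finite set \<Rightarrow> complex ^ 'n ^ 'n \<Rightarrow> complex ^ 'n \<Rightarrow> bool" where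
  "eigenvector_on J A x \<longleftrightarrow>
     x \<noteq> 0 \<and> (\<forall>r. r \<notin> J \<longrightarrow> x $ r = 0) \<and>
     (\<exists>\<mu>. \<forall>r\<in>J. (\<Sum>s\<in>J. A $ r $ s * x $ s) = \<mu> * x $ r)"

text \<open>
  The \<open>k\<close>-th eigenvalue, counted from 1 in increasing order and with multiplicity; meaningful for
  Hermitian \<open>A\<close>, where all roots of the characteristic polynomial are real.
\<close>

definition lam :: "nat \<Rightarrow> complex ^ 'n::finite ^ 'n \<Rightarrow> real" where
  "lam k A = sorted_list_of_multiset (image_mset Re (proots (charpoly A))) ! (k - 1)"

definition principal_submatrix :: "'n set \<Rightarrow> 'a::zero ^ 'n ^ 'n \<Rightarrow> 'a ^ 'n ^ 'n" where
  "principal_submatrix J h = (\<chi> r s. if r \<in> J \<and> s \<in> J then h $ r $ s else 0)"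

definition signing :: "real ^ 'n ^ 'n \<Rightarrow> real ^ 'n ^ 'n \<Rightarrow> bool" where
  "signing h h' \<longleftrightarrow>
     transpose h' = h' \<and> (\<forall>r. h' $ r $ r = h $ r $ r) \<and>
     (\<forall>r s. r \<noteq> s \<longrightarrow> h' $ r $ s = h $ r $ s \<or> h' $ r $ s = - h $ r $ s)"

definition generic :: "'n::finite rel \<Rightarrow> real ^ 'n ^ 'n \<Rightarrow> bool" where
  "generic E h \<longleftrightarrow>
     strictly_supported E h \<and>
     (\<forall>J h'. signing (principal_submatrix J h) h' \<longrightarrow>
        (\<forall>\<mu>. eigenvalue_on J (cmat h') \<mu> \<longrightarrow> simple_eigenvalue_on J (cmat h') \<mu>) \<and>
        (\<forall>x. eigenvector_on J (cmat h') x \<longrightarrow>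
           (\<exists>!C. C \<in> components E J \<and> (\<forall>r\<in>C. x $ r \<noteq> 0))))"

definition magnetic :: "real ^ 'n ^ 'n \<Rightarrow> real ^ 'n ^ 'n \<Rightarrow> complex ^ 'n ^ 'n" where
  "magnetic h \<alpha> = (\<chi> r s. exp (\<i> * complex_of_real (\<alpha> $ r $ s)) * complex_of_real (h $ r $ s))"

definition phase_diag :: "real ^ 'n \<Rightarrow> complex ^ 'n ^ 'n" where
  "phase_diag \<theta> = (\<chi> r s. if r = s then exp (\<i> * complex_of_real (\<theta> $ r)) else 0)"

definition gauge_equiv :: "complex ^ 'n::finite ^ 'n \<Rightarrow> complex ^ 'n ^ 'n \<Rightarrow> bool" where
  "gauge_equiv A B \<longleftrightarrow> (\<exists>\<theta>. B = phase_diag \<theta> ** A ** phase_diag (- \<theta>))"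

definition gauge_class :: "'n::finite rel \<Rightarrow> complex ^ 'n ^ 'n \<Rightarrow> (complex ^ 'n ^ 'n) set" where
  "gauge_class E A = {B \<in> Herm E. gauge_equiv A B}"

definition magnetic_torus :: "'n::finite rel \<Rightarrow> real ^ 'n ^ 'n \<Rightarrow> (complex ^ 'n ^ 'n) set set" where
  "magnetic_torus E h = (\<lambda>\<alpha>. gauge_class E (magnetic h \<alpha>)) ` Asym E"

definition signing_classes :: "'n::finite rel \<Rightarrow> real ^ 'n ^ 'n \<Rightarrow> (complex ^ 'n ^ 'n) set set" where
  "signing_classes E h =
     {c \<in> magnetic_torus E h. \<exists>h'. signing h h' \<and> c = gauge_class E (cmat h')}"

text \<open>
  \<open>\<lambda>\<^sub>k\<close> as a function of gauge classes; \<open>lam_class_gauge_class\<close> below shows that the choice of the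
  representative is immaterial.
\<close>

definition lam_class :: "nat \<Rightarrow> (complex ^ 'n::finite ^ 'n) set \<Rightarrow> real" where
  "lam_class k c = lam k (SOME A. A \<in> c)"

text \<open>
  The smooth structure of the magnetic torus is that of the quotient of the vector space
  \<open>Asym E\<close> by \<open>d\<real>\<^sup>V\<close> and the matrices with entries in \<open>2\<pi>\<int>\<close>. The quotient map
  \<open>\<alpha> \<mapsto> [h\<^sub>\<alpha>]\<close> is a submersion, so the differential of a function \<open>F\<close> on the torus vanishes at
  \<open>[h\<^sub>\<alpha>]\<close> iff the derivative of the lifted function on \<open>Asym E\<close> vanishes at \<open>\<alpha>\<close>. The lift is
  invariant under the translations above, hence the choice of \<open>\<alpha>\<close> in the class is immaterial.
\<close>

definition critical_point ::
  "'n::finite rel \<Rightarrow> real ^ 'n ^ 'n \<Rightarrow> ((complex ^ 'n ^ 'n) set \<Rightarrow> real) \<Rightarrow> (complex ^ 'n ^ 'n) set \<Rightarrow> bool"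
where
  "critical_point E h F c \<longleftrightarrow>
     (\<exists>\<alpha>\<in>Asym E. c = gauge_class E (magnetic h \<alpha>) \<and>
        ((\<lambda>\<beta>. F (gauge_class E (magnetic h \<beta>))) has_derivative (\<lambda>_. 0)) (at \<alpha> within Asym E))"

definition simple_critical_point ::
  "'n::finite rel \<Rightarrow> real ^ 'n ^ 'n \<Rightarrow> nat \<Rightarrow> (complex ^ 'n ^ 'n) set \<Rightarrow> bool"
where
  "simple_critical_point E h k c \<longleftrightarrow>
     critical_point E h (lam_class k) c \<and>
     (\<forall>A\<in>c. simple_eigenvalue_on UNIV A (complex_of_real (lam k A)))"

lemma phase_diag_conj_nth:
  "(phase_diag \<theta> ** A ** phase_diag (- \<theta>)) $ r $ s =
     exp (\<i> * complex_of_real (\<theta> $ r)) * A $ r $ s * exp (- (\<i> * complex_of_real (\<theta> $ s)))"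
proof -
  have L: "(phase_diag \<theta> ** X) $ r $ s = exp (\<i> * complex_of_real (\<theta> $ r)) * X $ r $ s" for X r s
    by (simp add: phase_diag_def matrix_matrix_mult_def if_distribR sum.delta' if_distrib[of "\<lambda>z. z * _"] cong: if_cong)
  have R: "(X ** phase_diag \<eta>) $ r $ s = X $ r $ s * exp (\<i> * complex_of_real (\<eta> $ s))" for X \<eta> r s
    by (simp add: phase_diag_def matrix_matrix_mult_def sum.delta if_distrib[of "\<lambda>z. _ * z"] cong: if_cong)
  show ?thesis
    by (simp add: R L)
qed

lemma charpoly_gauge_equiv:
  fixes A B :: "complex ^ 'n::finite ^ 'n"
  assumes "gauge_equiv A B"
  shows "charpoly B = charpoly A"
proof -
  from assms obtain \<theta> where B: "B = phase_diag \<theta> ** A ** phase_diag (- \<theta>)"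
    unfolding gauge_equiv_def by blast
  define e where "e = (\<lambda>r. exp (\<i> * complex_of_real (\<theta> $ r)))"
  define f where "f = (\<lambda>r. exp (- (\<i> * complex_of_real (\<theta> $ r))))"
  have ef: "e r * f r = 1" for r
    unfolding e_def f_def by (simp flip: exp_add)
  define M where "M = (\<lambda>A::complex^'n^'n. (\<chi> r s. (if r = s then [:0, 1:] else 0) - [:A $ r $ s:]))"
  have M: "M B $ r $ s = [:e r:] * [:f s:] * M A $ r $ s" for r s
  proof -
    have "B $ r $ s = e r * A $ r $ s * f s"
      by (simp only: B phase_diag_conj_nth e_def f_def)
    then show ?thesis
      using ef[of r] by (cases "r = s") (simp_all add: M_def algebra_simps)
  qed
  have "(\<Prod>r\<in>UNIV. M B $ r $ p r) = (\<Prod>r\<in>UNIV. M A $ r $ p r)" if p: "p permutes UNIV" for p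
  proof -
    have "(\<Prod>r\<in>UNIV. [:e r:] * [:f (p r):]) = (\<Prod>r\<in>UNIV. [:e r:]) * (\<Prod>r\<in>UNIV. [:f (p r):])"
      by (rule prod.distrib)
    also have "(\<Prod>r\<in>UNIV. [:f (p r):]) = (\<Prod>r\<in>UNIV. [:f r:])"
      using prod.permute[OF p, of "\<lambda>r. [:f r:]"] by (simp add: o_def)
    also have "(\<Prod>r\<in>UNIV. [:e r:]) * (\<Prod>r\<in>UNIV. [:f r:]) = (\<Prod>r\<in>UNIV. [:e r:] * [:f r:])"
      by (rule prod.distrib[symmetric])
    also have "\<dots> = 1"
      proof -
      have "[:e r:] * [:f r:] = 1" for r
        using ef[of r] by (simp add: one_pCons mult.commute)
      then show ?thesis
        by (simp only: prod.neutral_const)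
    qed
    finally show ?thesis
      unfolding M by (simp only: prod.distrib mult_1)
  qed
  then have "det_on UNIV (M B) = det_on UNIV (M A)"
    unfolding det_on_def by (intro sum.cong refl) simp
  then show ?thesis
    unfolding charpoly_on_def M_def .
qed

lemma lam_class_gauge_class:
  assumes "A \<in> Herm E"
  shows "lam_class k (gauge_class E A) = lam k A"
proof -
  have "gauge_equiv A A"
    unfolding gauge_equiv_def
    by (intro exI[of _ 0]) (simp add: vec_eq_iff phase_diag_conj_nth[of 0, simplified])
  with assms have "A \<in> gauge_class E A"
    by (simp add: gauge_class_def)
  then have "(SOME B. B \<in> gauge_class E A) \<in> gauge_class E A"
    by (rule someI)
  then have "gauge_equiv A (SOME B. B \<in> gauge_class E A)"
    by (simp only: gauge_class_def mem_Collect_eq)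
  from charpoly_gauge_equiv[OF this] show ?thesis
    by (simp only: lam_class_def lam_def)
qed

lemma magnetic_in_Herm:
  assumes "h \<in> Symm E" "\<alpha> \<in> Asym E"
  shows "magnetic h \<alpha> \<in> Herm E"
proof -
  have "transpose h = h" "transpose \<alpha> = - \<alpha>"
    using assms unfolding Symm_def Asym_def by blast+
  then have "transpose h $ r $ s = h $ r $ s" "transpose \<alpha> $ r $ s = (- \<alpha>) $ r $ s" for r s
    by (simp_all only:)
  then have h: "h $ s $ r = h $ r $ s" and \<alpha>: "\<alpha> $ s $ r = - \<alpha> $ r $ s" for r s
    unfolding transpose_def vec_lambda_beta vector_uminus_component by blast+
  have "magnetic h \<alpha> $ s $ r = cnj (magnetic h \<alpha> $ r $ s)" for r s
  proof -
    have "cnj (exp (\<i> * complex_of_real (\<alpha> $ r $ s))) = exp (\<i> * complex_of_real (- \<alpha> $ r $ s))"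
      unfolding exp_cnj complex_cnj_mult complex_cnj_i complex_cnj_complex_of_real by simp
    then show ?thesis
      unfolding magnetic_def vec_lambda_beta h[of s r] \<alpha>[of s r]
        complex_cnj_mult complex_cnj_complex_of_real by (rule arg_cong[OF sym])
  qed
  moreover have "supported E (magnetic h \<alpha>)"
    using assms(1) unfolding Symm_def supported_def magnetic_def by auto
  ultimately show ?thesis
    unfolding Herm_def by blast
qed

end

(*
  Along t -> h_(alpha + t K) the eigenvalue equation, paired with the eigenvector psi at t = 0, shows
  that a simple critical point is one where every cnj(psi_r) (h_alpha)_rs psi_s is real.  Gauging
  away the phases of psi makes h_alpha a real signing on the support J of psi.  By genericity J is
  connected; if J were not everything, a vertex r outside J adjacent to J would have at least two
  neighbours in J (look at row r of the eigenvalue equation) and at most two (three would give two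
  distinct cycles through r).  Then a suitable choice of the two signs at r makes psi an eigenvector
  of a signing on the connected graph J + r that vanishes at r, against genericity.  So psi vanishes
  nowhere and h_alpha is gauge equivalent to a signing.

  Conversely, at a signing the characteristic polynomial is an even function of the displacement in
  the torus, so its value at the k-th eigenvalue is o of the displacement; since the spectrum is
  simple this value is comparable with the displacement of the k-th eigenvalue.
*)

theory Submission
  imports Defs "HOL-Computational_Algebra.Fundamental_Theorem_Algebra"
begin

section \<open>Characteristic polynomials of Hermitian matrices\<close>

text \<open>\<open>Herm E\<close> without the support condition, so that the spectral facts below
  mention no graph.\<close>

definition hermitian :: "complex ^ 'n ^ 'n \<Rightarrow> bool" where
  "hermitian A \<longleftrightarrow> (\<forall>r s. A $ s $ r = cnj (A $ r $ s))"

lemma poly_charpoly: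
  fixes A :: "complex ^ 'n::finite ^ 'n"
  shows "poly (charpoly A) x = det (mat x - A)"
  unfolding charpoly_on_def det_on_def det_def
  by (auto simp: poly_sum poly_prod mat_def intro!: sum.cong prod.cong)

lemma coeff_linear_mult:
  fixes P :: "'a::comm_ring_1 poly"
  assumes "p = [:a, b:]" "degree P \<le> m"
  shows "coeff (p * P) (Suc m) = coeff p 1 * coeff P m"
  using assms by (simp add: coeff_eq_0)

text \<open>Applied to a single Leibniz term of a characteristic polynomial. The degree is only
  bounded, because the coefficient at \<open>card S\<close> vanishes as soon as one factor is
  constant.\<close>

lemma coeff_prod_linear:
  fixes q :: "'b \<Rightarrow> 'a::comm_ring_1 poly"
  assumes "finite S" "\<And>r. r \<in> S \<Longrightarrow> degree (q r) \<le> 1"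
  shows "degree (\<Prod>r\<in>S. q r) \<le> card S \<and> coeff (\<Prod>r\<in>S. q r) (card S) = (\<Prod>r\<in>S. coeff (q r) 1)"
  using assms
proof (induction S rule: finite_induct)
  case (insert a S)
  let ?P = "\<Prod>r\<in>S. q r"
  have P: "degree ?P \<le> card S" "coeff ?P (card S) = (\<Prod>r\<in>S. coeff (q r) 1)"
    using insert by auto
  have qa: "degree (q a) \<le> 1" using insert by auto
  have "degree (q a * ?P) \<le> 1 + card S"
    using degree_mult_le[of "q a" ?P] P(1) qa by linarith
  moreover have "q a = [:coeff (q a) 0, coeff (q a) 1:]"
    using qa by (auto simp: poly_eq_iff coeff_pCons coeff_eq_0 split: nat.split)
  then have "coeff (q a * ?P) (Suc (card S)) = coeff (q a) 1 * coeff ?P (card S)"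
    using P(1) by (metis coeff_linear_mult)
  ultimately show ?case
    using insert P by simp
qed simp

text \<open>In the top degree each Leibniz term contributes the product of the linear coefficients
  of its entries. These coefficients form the identity matrix, so the terms add up to its
  determinant.\<close>

lemma monic_charpoly:
  fixes A :: "complex ^ 'n::finite ^ 'n"
  shows "degree (charpoly A) = CARD('n)" "lead_coeff (charpoly A) = 1"
proof -
  let ?M = "\<lambda>r s. (if r = s then [:0, 1:] else 0) - [:A $ r $ s:]"
  have d: "degree (?M r s) \<le> 1" for r s
    by auto
  have c1: "coeff (?M r s) 1 = (mat 1 :: complex ^ 'n ^ 'n) $ r $ s" for r s
    by (auto simp: mat_def)
  have dp: "degree (\<Prod>r\<in>UNIV. ?M r (p r)) \<le> CARD('n)"
    and cp: "coeff (\<Prod>r\<in>UNIV. ?M r (p r)) (CARD('n)) = (\<Prod>r\<in>UNIV. (mat 1 :: complex ^ 'n ^ 'n) $ r $ p r)"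
    for p :: "'n \<Rightarrow> 'n"
    using coeff_prod_linear[of UNIV "\<lambda>r. ?M r (p r)"] d unfolding c1[symmetric] by auto
  have P: "charpoly A = (\<Sum>p | p permutes UNIV. of_int (sign p) * (\<Prod>r\<in>UNIV. ?M r (p r)))"
    by (simp add: charpoly_on_def det_on_def)
  have oi: "of_int k * q = smult (of_int k) q" for k and q :: "complex poly"
    by (simp add: of_int_poly)
  have "degree (charpoly A) \<le> CARD('n)"
    unfolding P oi by (intro degree_sum_le finite_permutations finite_class.finite_UNIV order.trans[OF degree_smult_le dp])
  moreover have "coeff (charpoly A) (CARD('n)) = det (mat 1 :: complex ^ 'n ^ 'n)"
    unfolding P oi coeff_sum coeff_smult cp det_def ..
  then have "coeff (charpoly A) (CARD('n)) = 1"
    by simp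
  ultimately show "degree (charpoly A) = CARD('n)" "lead_coeff (charpoly A) = 1"
    by (metis le_antisym le_degree zero_neq_one)+
qed

lemma charpoly_nonzero: "charpoly A \<noteq> 0"
  using monic_charpoly(2)[of A] by auto

lemma charpoly_root_eigenvector:
  fixes A :: "complex ^ 'n::finite ^ 'n"
  assumes "poly (charpoly A) \<mu> = 0"
  obtains x where "x \<noteq> 0" "\<And>r. (\<Sum>s\<in>UNIV. A $ r $ s * x $ s) = \<mu> * x $ r"
proof -
  have "\<not> invertible (mat \<mu> - A)"
    using assms by (simp add: invertible_det_nz poly_charpoly)
  then obtain x where x: "x \<noteq> 0" "(mat \<mu> - A) *v x = 0"
    using matrix_left_invertible_ker invertible_left_inverse by blast
  have "(\<Sum>s\<in>UNIV. A $ r $ s * x $ s) = \<mu> * x $ r" for r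
  proof -
    have "((mat \<mu> - A) *v x) $ r = 0" using x by simp
    then show ?thesis
      by (simp add: matrix_vector_mult_def mat_def left_diff_distrib sum_subtractf if_distrib[of "\<lambda>z. z * _"] cong: if_cong)
  qed
  with x show ?thesis by (intro that)
qed

text \<open>Self-adjointness. With \<open>y = x\<close> an eigenvector it forces real eigenvalues;
  with \<open>y\<close> a fixed eigenvector it gives the first variation of the eigenvalue.\<close>

lemma hermitian_form:
  fixes A :: "complex ^ 'n::finite ^ 'n"
  assumes "hermitian A"
  shows "(\<Sum>r\<in>UNIV. cnj (y $ r) * (\<Sum>s\<in>UNIV. A $ r $ s * x $ s)) =
         (\<Sum>r\<in>UNIV. cnj (\<Sum>s\<in>UNIV. A $ r $ s * y $ s) * x $ r)"
proof -
  have cA: "cnj (A $ s $ r) = A $ r $ s" for r s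
    using assms unfolding hermitian_def by metis
  have "(\<Sum>r\<in>UNIV. cnj (y $ r) * (\<Sum>s\<in>UNIV. A $ r $ s * x $ s)) =
        (\<Sum>r\<in>UNIV. \<Sum>s\<in>UNIV. cnj (y $ r) * A $ r $ s * x $ s)"
    by (simp add: sum_distrib_left mult.assoc)
  also have "\<dots> = (\<Sum>s\<in>UNIV. \<Sum>r\<in>UNIV. cnj (A $ s $ r) * cnj (y $ r) * x $ s)"
    unfolding cA by (subst sum.swap) (simp add: mult.commute)
  finally show ?thesis
    by (simp add: sum_distrib_right)
qed

lemma hermitian_root_real:
  fixes A :: "complex ^ 'n::finite ^ 'n"
  assumes "hermitian A" "poly (charpoly A) \<mu> = 0"
  shows "\<mu> = of_real (Re \<mu>)"
proof -
  obtain x where x: "x \<noteq> 0" "\<And>r. (\<Sum>s\<in>UNIV. A $ r $ s * x $ s) = \<mu> * x $ r"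
    using charpoly_root_eigenvector[OF assms(2)] by blast
  let ?N = "\<Sum>r\<in>UNIV. cnj (x $ r) * x $ r"
  have N: "?N = of_real (\<Sum>r\<in>UNIV. (cmod (x $ r))\<^sup>2)"
    unfolding of_real_sum by (intro sum.cong refl) (metis complex_norm_square mult.commute of_real_power)
  have "(\<Sum>r\<in>UNIV. (cmod (x $ r))\<^sup>2) \<noteq> 0"
    using x(1) by (simp add: sum_nonneg_eq_0_iff vec_eq_iff)
  then have N0: "?N \<noteq> 0" unfolding N by (metis of_real_eq_0_iff)
  have "\<mu> * ?N = cnj \<mu> * ?N"
    using hermitian_form[OF assms(1), of x x] unfolding x(2)
    by (simp add: sum_distrib_left mult.left_commute mult.assoc)
  then have "cnj \<mu> = \<mu>" using N0 by simp
  then show ?thesis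
    by (simp add: complex_eq_iff)
qed

lemma lam_nth:
  assumes "sorted xs" "image_mset Re (proots (charpoly A)) = mset xs"
  shows "lam k A = xs ! (k - 1)"
  using assms by (simp add: lam_def sorted_list_of_multiset_mset sorted_sort_id)

lemma poly_prod_mset_linear:
  "poly (\<Prod>x\<in>#M. [:-f x, 1:]) t = (\<Prod>x\<in>#M. t - f x)" for t :: "'a::comm_ring_1"
  by (induction M) (auto simp: algebra_simps)

text \<open>Passes from the multiset of complex roots to a sorted real list with the
  \<open>k\<close>-th eigenvalue at index \<open>k - 1\<close>. Perturbation then becomes a question
  about real lists and products of real factors.\<close>

lemma hermitian_eigenvalue_list:
  fixes A :: "complex ^ 'n::finite ^ 'n"
  assumes "hermitian A"
  obtains xs where "sorted xs" "length xs = CARD('n)" "\<And>k. lam k A = xs ! (k - 1)"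
    "proots (charpoly A) = image_mset of_real (mset xs)"
    "\<And>t. det (mat (of_real t) - A) = of_real (\<Prod>i<CARD('n). t - xs ! i)"
proof -
  define xs where "xs = sorted_list_of_multiset (image_mset Re (proots (charpoly A)))"
  have s: "sorted xs" and m: "mset xs = image_mset Re (proots (charpoly A))"
    by (simp_all add: xs_def)
  have len: "length xs = CARD('n)"
    by (metis m size_mset size_image_mset size_proots_complex monic_charpoly(1))
  have p: "proots (charpoly A) = image_mset of_real (mset xs)"
  proof -
    have "image_mset (\<lambda>x. of_real (Re x)) (proots (charpoly A)) = image_mset (\<lambda>x. x) (proots (charpoly A))"
    proof (rule image_mset_cong)
      fix x assume "x \<in># proots (charpoly A)"
      then show "complex_of_real (Re x) = x"
        using hermitian_root_real[OF assms] charpoly_nonzero[of A] by simp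
    qed
    then show ?thesis by (simp add: m image_mset.compositionality o_def)
  qed
  have "det (mat (of_real t) - A) = of_real (\<Prod>i<CARD('n). t - xs ! i)" for t
  proof -
    have "charpoly A = (\<Prod>x\<in>#proots (charpoly A). [:-x, 1:])"
      by (metis complex_poly_decompose_multiset monic_charpoly(2) smult_1_left)
    then have "poly (charpoly A) (of_real t) = poly (\<Prod>x\<in>#proots (charpoly A). [:-x, 1:]) (of_real t)"
      by simp
    also have "\<dots> = (\<Prod>x\<in>#mset xs. of_real t - of_real x)"
      unfolding p by (simp add: poly_prod_mset_linear image_mset.compositionality comp_def)
    also have "\<dots> = (\<Prod>x\<leftarrow>xs. of_real (t - x))"
      by (simp flip: mset_map add: prod_mset_prod_list)
    also have "\<dots> = (\<Prod>i<CARD('n). of_real (t - xs ! i))"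
      by (simp add: prod.list_conv_set_nth len lessThan_atLeast0)
    finally show ?thesis
      by (simp add: poly_charpoly)
  qed
  then show ?thesis
    by (rule that[OF s len lam_nth[OF s m[symmetric]] p])
qed

lemma hermitian_lam_root:
  fixes A :: "complex ^ 'n::finite ^ 'n"
  assumes "hermitian A" "k \<in> {1..CARD('n)}"
  shows "poly (charpoly A) (of_real (lam k A)) = 0"
proof -
  obtain xs where xs: "\<And>k. lam k A = xs ! (k - 1)"
    "\<And>t. det (mat (of_real t) - A) = of_real (\<Prod>i<CARD('n). t - xs ! i)"
    using hermitian_eigenvalue_list[OF assms(1)] by metis
  show ?thesis
    unfolding poly_charpoly xs using assms(2) by (intro of_real_eq_0_iff[THEN iffD2] prod_zero) (auto intro: bexI[of _ "k - 1"])
qed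

section \<open>Simple roots have one-dimensional eigenspaces\<close>

lemma det_replace_row_combination:
  fixes C :: "'a::field ^ 'n ^ 'n"
  assumes "u j = 1"
  shows "det (\<chi> i. if i = j then (\<Sum>s\<in>UNIV. u s *s row s C) else row i C) = det C"
proof -
  have "(\<Sum>s\<in>UNIV - {j}. u s *s row s C) \<in> vec.span {row i C |i. i \<noteq> j}"
    by (intro vec.span_sum vec.span_scale vec.span_base) auto
  then have "det (\<chi> i. if i = j then row j C + (\<Sum>s\<in>UNIV - {j}. u s *s row s C) else row i C) = det C"
    by (rule det_row_span)
  moreover have "row j C + (\<Sum>s\<in>UNIV - {j}. u s *s row s C) = (\<Sum>s\<in>UNIV. u s *s row s C)"
    using assms by (simp add: sum.remove[of UNIV j])
  ultimately show ?thesis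
    by (simp only:)
qed

text \<open>Row \<open>j\<close> is replaced first. Since \<open>v j = 0\<close>, the combination
  put into row \<open>k\<close> does not see the changed row, so the one-row statement applies a
  second time.\<close>

lemma det_replace_two_rows:
  fixes C :: "'a::field ^ 'n ^ 'n"
  assumes "u j = 1" "v j = 0" "v k = 1"
  shows "det (\<chi> i. if i = k then (\<Sum>s\<in>UNIV. v s *s row s C)
            else if i = j then (\<Sum>s\<in>UNIV. u s *s row s C) else row i C) = det C"
proof -
  define D where "D = (\<chi> i. if i = j then (\<Sum>s\<in>UNIV. u s *s row s C) else row i C)"
  have row: "row i D = (if i = j then (\<Sum>s\<in>UNIV. u s *s row s C) else row i C)" for i
    by (simp add: row_def D_def vec_eq_iff)
  have "v s *s row s D = v s *s row s C" for s
    by (simp add: row assms)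
  then have "(\<chi> i. if i = k then (\<Sum>s\<in>UNIV. v s *s row s C)
            else if i = j then (\<Sum>s\<in>UNIV. u s *s row s C) else row i C) =
        (\<chi> i. if i = k then (\<Sum>s\<in>UNIV. v s *s row s D) else row i D)"
    by (simp only: row)
  then show ?thesis
    using det_replace_row_combination[of v k D] det_replace_row_combination[of u j C] assms
    by (simp add: D_def)
qed

text \<open>The columns of \<open>mat x - A\<close>, combined with the coefficients of an
  eigenvector \<open>w\<close>, give \<open>(x - \<mu>) *s w\<close>. Replacing columns
  \<open>j\<close> and \<open>k\<close> in this way by multiples of \<open>u\<close> and
  \<open>v\<close> splits off the square of \<open>x - \<mu>\<close>. The normalisation of
  \<open>u\<close> and \<open>v\<close> at \<open>j\<close> and \<open>k\<close> is what keeps the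
  determinant unchanged.\<close>

lemma charpoly_double_root:
  fixes A :: "complex ^ 'n::finite ^ 'n"
  assumes u: "\<And>r. (\<Sum>s\<in>UNIV. A $ r $ s * u $ s) = \<mu> * u $ r"
    and v: "\<And>r. (\<Sum>s\<in>UNIV. A $ r $ s * v $ s) = \<mu> * v $ r"
    and uv: "u $ j = 1" "u $ k = 0" "v $ j = 0" "v $ k = 1"
  shows "order \<mu> (charpoly A) \<noteq> 1"
proof
  assume o: "order \<mu> (charpoly A) = 1"
  define C where "C = (\<lambda>x. transpose (mat x - A))"
  define N where "N = (\<lambda>x. (\<chi> i. if i = k then v else if i = j then u else row i (C x)))"
  have comb: "(\<Sum>s\<in>UNIV. w $ s *s row s (C x)) = (x - \<mu>) *s w"
    if w: "\<And>r. (\<Sum>s\<in>UNIV. A $ r $ s * w $ s) = \<mu> * w $ r" for w x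
  proof -
    have "(\<Sum>s\<in>UNIV. w $ s *s row s (C x)) $ r = (x - \<mu>) * w $ r" for r
    proof -
      have "(\<Sum>s\<in>UNIV. w $ s *s row s (C x)) $ r = (\<Sum>s\<in>UNIV. (if r = s then x * w $ s else 0) - A $ r $ s * w $ s)"
        unfolding sum_component
        by (intro sum.cong refl) (simp add: C_def row_def transpose_def mat_def algebra_simps)
      also have "\<dots> = (x - \<mu>) * w $ r"
        by (simp only: sum_subtractf w) (simp add: algebra_simps)
      finally show ?thesis .
    qed
    then show ?thesis
      by (simp only: vec_eq_iff vector_smult_component) simp
  qed
  have jk: "j \<noteq> k" using uv by auto
  have det: "poly (charpoly A) x = (x - \<mu>)\<^sup>2 * det (N x)" for x
  proof -
    have "poly (charpoly A) x = det (C x)"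
      by (simp add: C_def poly_charpoly)
    also have "\<dots> = det (\<chi> i. if i = k then (x - \<mu>) *s v
            else if i = j then (x - \<mu>) *s u else row i (C x))"
      using det_replace_two_rows[of "($) u" j "($) v" k "C x"] uv
      unfolding comb[OF u] comb[OF v] by simp
    also have "\<dots> = (x - \<mu>) * det (\<chi> i. if i = k then v
            else if i = j then (x - \<mu>) *s u else row i (C x))"
      by (rule det_row_mul[of k _ "\<lambda>_. v"])
    also have "(\<chi> i. if i = k then v else if i = j then (x - \<mu>) *s u else row i (C x)) =
       (\<chi> i. if i = j then (x - \<mu>) *s u else if i = k then v else row i (C x))"
      using jk by (auto simp: vec_eq_iff)
    also have "det \<dots> = (x - \<mu>) * det (\<chi> i. if i = j then u else if i = k then v else row i (C x))"
      by (rule det_row_mul[of j _ "\<lambda>_. u"])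
    also have "(\<chi> i. if i = j then u else if i = k then v else row i (C x)) = N x"
      using jk by (auto simp: vec_eq_iff N_def)
    finally show ?thesis by (simp add: power2_eq_square mult.assoc)
  qed
  obtain q where q: "charpoly A = [:-\<mu>, 1:] * q" and "\<not> [:-\<mu>, 1:] dvd q"
    using order_decomp[of "charpoly A" \<mu>, OF charpoly_nonzero] unfolding o by auto
  then have q0: "poly q \<mu> \<noteq> 0"
    by (simp add: poly_eq_0_iff_dvd)
  \<comment> \<open>The cofactor \<open>det (N x)\<close> is treated as a continuous function, not
    as a polynomial: one factor is cancelled away from \<open>\<mu>\<close>, and the limit at
    \<open>\<mu>\<close> then contradicts \<open>q0\<close>.\<close>
  have qN: "poly q x = (x - \<mu>) * det (N x)" if "x \<noteq> \<mu>" for x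
  proof -
    have "(x - \<mu>) * poly q x = (x - \<mu>) * ((x - \<mu>) * det (N x))"
    proof -
      have "(x - \<mu>) * poly q x = poly (charpoly A) x"
        by (simp add: q algebra_simps)
      then show ?thesis
        by (simp only: det power2_eq_square mult.assoc)
    qed
    then show ?thesis using that by (metis mult_left_cancel eq_iff_diff_eq_0)
  qed
  have "continuous_on UNIV (\<lambda>x. (if s = r then x else 0) - A $ s $ r)" for r s
    by (cases "s = r") (auto intro!: continuous_intros)
  then have "continuous_on UNIV (\<lambda>x. N x $ r $ s)" for r s
    by (cases "r = k"; cases "r = j") (simp_all add: N_def row_def C_def transpose_def mat_def)
  then have "continuous_on UNIV (\<lambda>x. (x - \<mu>) * det (N x))"
    unfolding det_def
    by (intro continuous_on_mult continuous_on_sum continuous_on_prod continuous_on_diff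
        continuous_on_id continuous_on_const)
  then have "(\<lambda>x. (x - \<mu>) * det (N x)) \<midarrow>\<mu>\<rightarrow> (\<mu> - \<mu>) * det (N \<mu>)"
    by (simp only: continuous_on_eq_continuous_at[OF open_UNIV] isCont_def) blast
  then have "poly q \<midarrow>\<mu>\<rightarrow> 0"
    by (subst (asm) LIM_cong[OF refl qN[symmetric] refl]) simp_all
  moreover have "poly q \<midarrow>\<mu>\<rightarrow> poly q \<mu>"
    using poly_isCont isCont_def by blast
  ultimately show False
    using q0 LIM_unique by blast
qed

text \<open>Subtracting from \<open>y\<close> the multiple of \<open>x\<close> with the same
  coordinate \<open>j\<close> leaves an eigenvector vanishing at \<open>j\<close>. If it were
  nonzero, it would be independent of \<open>x\<close>, and the root would not be simple.\<close>

lemma simple_root_eigenvector_unique: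
  fixes A :: "complex ^ 'n::finite ^ 'n"
  assumes o: "order \<mu> (charpoly A) = 1"
    and x: "x \<noteq> 0" "\<And>r. (\<Sum>s\<in>UNIV. A $ r $ s * x $ s) = \<mu> * x $ r"
    and y: "\<And>r. (\<Sum>s\<in>UNIV. A $ r $ s * y $ s) = \<mu> * y $ r"
  obtains c where "y = c *s x"
proof -
  have lin: "(\<Sum>s\<in>UNIV. A $ r $ s * (a *s w + b *s z) $ s) = \<mu> * (a *s w + b *s z) $ r"
    if "\<And>r. (\<Sum>s\<in>UNIV. A $ r $ s * w $ s) = \<mu> * w $ r"
      "\<And>r. (\<Sum>s\<in>UNIV. A $ r $ s * z $ s) = \<mu> * z $ r" for a b w z r
  proof -
    have "(\<Sum>s\<in>UNIV. A $ r $ s * (a *s w + b *s z) $ s) =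
        a * (\<Sum>s\<in>UNIV. A $ r $ s * w $ s) + b * (\<Sum>s\<in>UNIV. A $ r $ s * z $ s)"
      by (simp add: algebra_simps sum.distrib sum_distrib_left)
    then show ?thesis unfolding that by (simp add: algebra_simps)
  qed
  obtain j where j: "x $ j \<noteq> 0" using x(1) by (auto simp: vec_eq_iff)
  define w where "w = 1 *s y + (- (y $ j / x $ j)) *s x"
  have w: "(\<Sum>s\<in>UNIV. A $ r $ s * w $ s) = \<mu> * w $ r" for r
    unfolding w_def by (rule lin[OF y x(2)])
  have wj: "w $ j = 0" using j by (simp add: w_def)
  have "w = 0"
  proof (rule ccontr)
    assume "w \<noteq> 0"
    then obtain k where k: "w $ k \<noteq> 0" by (auto simp: vec_eq_iff)
    \<comment> \<open>Brings the pair into the normalised shape required by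
      \<open>charpoly_double_root\<close>; the zero summand only fits \<open>v\<close> to the
      two-term form of \<open>lin\<close>.\<close>
    define v where "v = (1 / w $ k) *s w + 0 *s w"
    define u where "u = (1 / x $ j) *s x + (- (x $ k / x $ j)) *s v"
    have v: "(\<Sum>s\<in>UNIV. A $ r $ s * v $ s) = \<mu> * v $ r" for r
      unfolding v_def by (rule lin[OF w w])
    have u: "(\<Sum>s\<in>UNIV. A $ r $ s * u $ s) = \<mu> * u $ r" for r
      unfolding u_def by (rule lin[OF x(2) v])
    have "v $ j = 0" "v $ k = 1" using k by (simp_all add: v_def wj)
    moreover from this have "u $ j = 1" "u $ k = 0" using j by (simp_all add: u_def)
    ultimately show False
      using charpoly_double_root[OF u v] o by blast
  qed
  then have "y = (y $ j / x $ j) *s x"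
    unfolding w_def by (metis (no_types) vector_smult_lneg vec.scale_one add_uminus_conv_diff eq_iff_diff_eq_0)
  then show ?thesis by (rule that)
qed

section \<open>Signings are critical\<close>

text \<open>Each step raises \<open>\<sigma>\<close> by at least 1. Counting up from 0 gives
  \<open>j \<le> \<sigma> j\<close>, and counting up from \<open>j\<close> to \<open>n - 1\<close>
  leaves no room for \<open>\<sigma> j > j\<close>.\<close>

lemma strict_mono_self_map_id:
  fixes \<sigma> :: "nat \<Rightarrow> nat"
  assumes lt: "\<And>j. j < n \<Longrightarrow> \<sigma> j < n" and mono: "\<And>i j. i < j \<Longrightarrow> j < n \<Longrightarrow> \<sigma> i < \<sigma> j"
    and j: "j < n"
  shows "\<sigma> j = j"
proof -
  have step: "\<sigma> i + d \<le> \<sigma> (i + d)" if "i + d < n" for i d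
    using that
  proof (induction d)
    case (Suc d)
    then show ?case using mono[of "i + d" "i + Suc d"] by simp
  qed simp
  have "j \<le> \<sigma> j" using step[of 0 j] j by simp
  moreover have "\<sigma> j + (n - 1 - j) \<le> \<sigma> (n - 1)" using step[of j "n - 1 - j"] j by simp
  ultimately show ?thesis using lt[of "n - 1"] j by linarith
qed

text \<open>Choose for each \<open>xs ! j\<close> an index \<open>\<sigma> j\<close> of a nearby
  entry of \<open>ys\<close>. Gaps of at least \<open>2 * \<delta>\<close> force
  \<open>\<sigma>\<close> to be strictly increasing, hence the identity: nearness in some position
  becomes nearness in the same position.\<close>

lemma separated_lists_close:
  fixes xs ys :: "real list"
  assumes ys: "sorted ys" "length ys = n"
    and sep: "\<And>i j. i < j \<Longrightarrow> j < n \<Longrightarrow> xs ! i + 2 * \<delta> \<le> xs ! j"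
    and near: "\<And>j. j < n \<Longrightarrow> \<exists>i<n. \<bar>xs ! j - ys ! i\<bar> < \<delta>"
    and j: "j < n"
  shows "\<bar>xs ! j - ys ! j\<bar> < \<delta>"
proof -
  from near obtain \<sigma> where \<sigma>: "\<And>j. j < n \<Longrightarrow> \<sigma> j < n" "\<And>j. j < n \<Longrightarrow> \<bar>xs ! j - ys ! \<sigma> j\<bar> < \<delta>"
    by metis
  have "\<sigma> i < \<sigma> j" if "i < j" "j < n" for i j
  proof (rule ccontr)
    assume "\<not> \<sigma> i < \<sigma> j"
    then have "ys ! \<sigma> j \<le> ys ! \<sigma> i"
      using ys \<sigma>(1)[of i] that by (auto intro: sorted_nth_mono)
    then show False
      using sep[OF that] \<sigma>(2)[of i] \<sigma>(2)[of j] that by linarith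
  qed
  with \<sigma>(1) have "\<sigma> j = j"
    using j by (rule strict_mono_self_map_id)
  then show ?thesis using \<sigma>(2)[OF j] by simp
qed

lemma distinct_sorted_separated:
  fixes xs :: "real list"
  assumes "sorted xs" "distinct xs"
  obtains \<delta> where "\<delta> > 0" "\<And>i j. i < j \<Longrightarrow> j < length xs \<Longrightarrow> xs ! i + 2 * \<delta> \<le> xs ! j"
proof -
  \<comment> \<open>The element 1 keeps \<open>G\<close> nonempty when the list has at most one
    entry, so that \<open>Min G\<close> is meaningful.\<close>
  define G where "G = insert 1 {xs ! j - xs ! i |i j. i < j \<and> j < length xs}"
  have "{xs ! j - xs ! i |i j. i < j \<and> j < length xs}
      \<subseteq> (\<lambda>(i, j). xs ! j - xs ! i) ` ({..<length xs} \<times> {..<length xs})"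
    by force
  then have fin: "finite G"
    unfolding G_def by (meson finite.insertI finite_SigmaI finite_imageI finite_lessThan finite_subset)
  have "\<forall>g\<in>G. g > 0"
    using assms by (auto simp: G_def sorted_iff_nth_mono order_less_le distinct_conv_nth)
  then have "Min G > 0"
    using fin by (simp add: G_def)
  moreover have "Min G \<le> xs ! j - xs ! i" if "i < j" "j < length xs" for i j
    using fin by (rule Min_le) (use that in \<open>auto simp: G_def\<close>)
  ultimately show ?thesis
    by (intro that[of "Min G / 2"]) (auto simp: algebra_simps)
qed

lemma prod_eq_power_bound:
  fixes f :: "nat \<Rightarrow> real"
  assumes "\<bar>\<Prod>i<n. f i\<bar> < \<delta> ^ n" "\<delta> > 0"
  shows "\<exists>i<n. \<bar>f i\<bar> < \<delta>"
proof (rule ccontr)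
  assume "\<not> ?thesis"
  then have "(\<Prod>i<n. \<delta>) \<le> (\<Prod>i<n. \<bar>f i\<bar>)"
    using assms by (intro prod_mono) force
  then show False using assms by (simp add: abs_prod)
qed

text \<open>
  Near a Hermitian matrix with simple spectrum the ordered eigenvalues stay close to their original
  positions, so the factor belonging to the \<open>k\<close>-th one controls the characteristic polynomial.
\<close>

lemma simple_spectrum_lam_bound:
  fixes M :: "'a::t2_space \<Rightarrow> complex ^ 'n::finite ^ 'n"
  assumes herm: "\<And>\<beta>. \<beta> \<in> S \<Longrightarrow> hermitian (M \<beta>)" and \<alpha>: "\<alpha> \<in> S"
    and cont: "\<And>t. ((\<lambda>\<beta>. det (mat t - M \<beta>)) \<longlongrightarrow> det (mat t - M \<alpha>)) (at \<alpha> within S)"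
    and simple: "\<And>\<mu>. poly (charpoly (M \<alpha>)) \<mu> = 0 \<Longrightarrow> order \<mu> (charpoly (M \<alpha>)) = 1"
    and k: "k \<in> {1..CARD('n)}"
  obtains c where "c > 0"
    "\<forall>\<^sub>F \<beta> in at \<alpha> within S. c * \<bar>lam k (M \<beta>) - lam k (M \<alpha>)\<bar> \<le>
        cmod (det (mat (of_real (lam k (M \<alpha>))) - M \<beta>))"
proof -
  let ?n = "CARD('n)"
  obtain xs where xs: "sorted xs" "length xs = ?n" "\<And>k. lam k (M \<alpha>) = xs ! (k - 1)"
    "proots (charpoly (M \<alpha>)) = image_mset of_real (mset xs)"
    "\<And>t. det (mat (of_real t) - M \<alpha>) = of_real (\<Prod>i<?n. t - xs ! i)"
    using hermitian_eigenvalue_list[OF herm[OF \<alpha>]] by metis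
  have "count (mset xs) x \<le> 1" for x
  proof (cases "x \<in># mset xs")
    case True
    then have "of_real x \<in># proots (charpoly (M \<alpha>))"
      unfolding xs(4) by auto
    then have "count (proots (charpoly (M \<alpha>))) (of_real x) = 1"
      using simple[of "of_real x"] charpoly_nonzero[of "M \<alpha>"] by auto
    moreover have "count (mset xs) x \<le> count (proots (charpoly (M \<alpha>))) (of_real x)"
      unfolding xs(4) count_image_mset using True by (auto intro: member_le_sum)
    ultimately show ?thesis by simp
  next
    case False
    then have "count (mset xs) x = 0" by (simp only: not_in_iff)
    then show ?thesis by (simp only: zero_le)
  qed
  then have "distinct xs"
    unfolding distinct_count_atmost_1 by (metis count_eq_zero_iff le_antisym less_one linorder_not_less set_mset_mset)
  then obtain \<delta> where \<delta>: "\<delta> > 0" and sep: "\<And>i j. i < j \<Longrightarrow> j < ?n \<Longrightarrow> xs ! i + 2 * \<delta> \<le> xs ! j"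
    using distinct_sorted_separated[OF xs(1)] unfolding xs(2) by metis
  \<comment> \<open>A lower bound for the product of the \<open>?n - 1\<close> factors that belong
    to the other eigenvalues, each of which will be at least \<open>\<delta>\<close>.\<close>
  define c where "c = \<delta> ^ (?n - 1)"
  have "\<forall>\<^sub>F \<beta> in at \<alpha> within S. cmod (det (mat (of_real (xs ! j)) - M \<beta>)) < \<delta> ^ ?n" if "j < ?n" for j
  proof -
    have "det (mat (of_real (xs ! j)) - M \<alpha>) = 0"
      unfolding xs(5) using that by (auto intro: prod_zero)
    then have "((\<lambda>\<beta>. det (mat (of_real (xs ! j)) - M \<beta>)) \<longlongrightarrow> 0) (at \<alpha> within S)"
      using cont by metis
    from tendstoD[OF this, of "\<delta> ^ ?n"] show ?thesis using \<delta> by simp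
  qed
  then have "\<forall>\<^sub>F \<beta> in at \<alpha> within S. \<forall>j\<in>{..<?n}. cmod (det (mat (of_real (xs ! j)) - M \<beta>)) < \<delta> ^ ?n"
    by (intro eventually_ball_finite) auto
  moreover have "\<forall>\<^sub>F \<beta> in at \<alpha> within S. \<beta> \<in> S"
    by (simp add: eventually_at_filter)
  ultimately have "\<forall>\<^sub>F \<beta> in at \<alpha> within S. c * \<bar>lam k (M \<beta>) - lam k (M \<alpha>)\<bar> \<le>
        cmod (det (mat (of_real (lam k (M \<alpha>))) - M \<beta>))"
  proof eventually_elim
    case (elim \<beta>)
    obtain ys where ys: "sorted ys" "length ys = ?n" "\<And>k. lam k (M \<beta>) = ys ! (k - 1)"
      "\<And>t. det (mat (of_real t) - M \<beta>) = of_real (\<Prod>i<?n. t - ys ! i)"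
      using hermitian_eigenvalue_list[OF herm[OF elim(2)]] by metis
    \<comment> \<open>The determinant at \<open>xs ! j\<close> is a product of \<open>?n\<close>
      factors and is smaller than \<open>\<delta> ^ ?n\<close>, so one of the factors is smaller
      than \<open>\<delta>\<close>.\<close>
    have near: "\<exists>i<?n. \<bar>xs ! j - ys ! i\<bar> < \<delta>" if "j < ?n" for j
    proof (rule prod_eq_power_bound[OF _ \<delta>])
      have "cmod (of_real (\<Prod>i<?n. xs ! j - ys ! i)) < \<delta> ^ ?n"
        using elim(1) that unfolding ys(4) by blast
      then show "\<bar>\<Prod>i<?n. xs ! j - ys ! i\<bar> < \<delta> ^ ?n"
        unfolding norm_of_real .
    qed
    have close: "\<bar>xs ! j - ys ! j\<bar> < \<delta>" if "j < ?n" for j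
      using ys(1,2) sep near that by (rule separated_lists_close)
    define j where "j = k - 1"
    have j: "j < ?n" using k by (auto simp: j_def)
    \<comment> \<open>The gap \<open>2 * \<delta>\<close> loses less than \<open>\<delta>\<close> by
      the displacement of \<open>ys ! i\<close>.\<close>
    have far: "\<delta> \<le> \<bar>xs ! j - ys ! i\<bar>" if "i < ?n" "i \<noteq> j" for i
      using close[OF that(1)] sep[of i j] sep[of j i] that j \<delta> by (cases "i < j") (auto simp: not_less)
    have "c = (\<Prod>i\<in>{..<?n} - {j}. \<delta>)"
      using j by (simp add: c_def)
    also have "\<dots> \<le> (\<Prod>i\<in>{..<?n} - {j}. \<bar>xs ! j - ys ! i\<bar>)"
      using \<delta> far by (intro prod_mono) auto
    finally have "\<bar>xs ! j - ys ! j\<bar> * c \<le> \<bar>xs ! j - ys ! j\<bar> * (\<Prod>i\<in>{..<?n} - {j}. \<bar>xs ! j - ys ! i\<bar>)"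
      by (rule mult_left_mono) simp
    also have "\<dots> = \<bar>\<Prod>i<?n. xs ! j - ys ! i\<bar>"
      using j unfolding abs_prod by (subst prod.remove[of "{..<?n}" j]) auto
    finally show ?case
      unfolding xs(3) ys(3,4) norm_of_real j_def by (simp add: mult.commute abs_minus_commute)
  qed
  moreover have "c > 0" using \<delta> by (simp add: c_def)
  ultimately show ?thesis by (intro that)
qed

section \<open>Magnetic matrices and the characteristic polynomial along the torus\<close>

lemma hermitian_magnetic:
  assumes "h \<in> Symm E" "\<alpha> \<in> Asym E"
  shows "hermitian (magnetic h \<alpha>)"
proof -
  have "magnetic h \<alpha> \<in> {h. (\<forall>r s. h $ s $ r = cnj (h $ r $ s)) \<and> supported E h}"
    using magnetic_in_Herm[OF assms] unfolding Herm_def .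
  then show ?thesis
    unfolding hermitian_def mem_Collect_eq by (rule conjunct1)
qed

lemma Asym_iff: "\<alpha> \<in> Asym E \<longleftrightarrow> (\<forall>r s. \<alpha> $ s $ r = - \<alpha> $ r $ s) \<and> supported E \<alpha>"
  unfolding Asym_def transpose_def mem_Collect_eq vec_eq_iff vec_lambda_beta vector_uminus_component
  by (rule refl)

lemma Asym_antisym: "\<alpha> \<in> Asym E \<Longrightarrow> \<alpha> $ s $ r = - \<alpha> $ r $ s"
  unfolding Asym_iff by blast

lemma Symm_sym: "h \<in> Symm E \<Longrightarrow> h $ s $ r = h $ r $ s"
  unfolding Symm_def transpose_def mem_Collect_eq vec_eq_iff vec_lambda_beta by blast

lemma Asym_lincomb:
  assumes "\<alpha> \<in> Asym E" "\<beta> \<in> Asym E"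
  shows "a *\<^sub>R \<alpha> + b *\<^sub>R \<beta> \<in> Asym E"
proof -
  have "(a *\<^sub>R \<alpha> + b *\<^sub>R \<beta>) $ s $ r = - (a *\<^sub>R \<alpha> + b *\<^sub>R \<beta>) $ r $ s" for r s
    using Asym_antisym[OF assms(1), of s r] Asym_antisym[OF assms(2), of s r] by simp
  moreover have "supported E (a *\<^sub>R \<alpha> + b *\<^sub>R \<beta>)"
  proof -
    have "\<alpha> $ r $ s \<noteq> 0 \<or> \<beta> $ r $ s \<noteq> 0" if "(a *\<^sub>R \<alpha> + b *\<^sub>R \<beta>) $ r $ s \<noteq> 0" for r s
      using that by auto
    then show ?thesis
      using assms unfolding Asym_iff supported_def by blast
  qed
  ultimately show ?thesis
    unfolding Asym_iff by blast
qed

text \<open>Only the existence of a derivative is recorded; at a real matrix a symmetry argument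
  determines it on \<open>Asym E\<close>.\<close>

lemma det_magnetic_differentiable:
  fixes h :: "real ^ 'n::finite ^ 'n"
  shows "\<exists>D. ((\<lambda>\<beta>. det (mat t - magnetic h \<beta>)) has_derivative D) (at \<alpha>)"
proof -
  have "\<exists>d. ((\<lambda>\<beta>. (mat t - magnetic h \<beta>) $ r $ s) has_derivative d) (at \<alpha>)" for r s
  proof -
    have "((\<lambda>\<beta>::real^'n^'n. \<i> * of_real (\<beta> $ r $ s)) has_derivative (\<lambda>\<beta>. \<i> * of_real (\<beta> $ r $ s))) (at \<alpha>)"
      by (intro derivative_intros bounded_linear.has_derivative[OF bounded_linear_vec_nth])
    from has_derivative_compose[OF this DERIV_exp[unfolded has_field_derivative_def]]
    have "\<exists>d. ((\<lambda>\<beta>. exp (\<i> * of_real (\<beta> $ r $ s))) has_derivative d) (at \<alpha>)"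
      by blast
    then obtain d where "((\<lambda>\<beta>. exp (\<i> * of_real (\<beta> $ r $ s))) has_derivative d) (at \<alpha>)" ..
    then have "((\<lambda>\<beta>. mat t $ r $ s - exp (\<i> * of_real (\<beta> $ r $ s)) * of_real (h $ r $ s)) has_derivative
        (\<lambda>\<beta>. 0 - d \<beta> * of_real (h $ r $ s))) (at \<alpha>)"
      by (intro has_derivative_diff has_derivative_const has_derivative_mult_left)
    then show ?thesis
      unfolding magnetic_def vector_minus_component vec_lambda_beta by blast
  qed
  then obtain d where d: "\<And>r s. ((\<lambda>\<beta>. (mat t - magnetic h \<beta>) $ r $ s) has_derivative d r s) (at \<alpha>)"
    by metis
  have "\<exists>D. ((\<lambda>\<beta>. of_int (sign p) * (\<Prod>r\<in>UNIV. (mat t - magnetic h \<beta>) $ r $ p r)) has_derivative D) (at \<alpha>)" for p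
    by (rule exI, rule has_derivative_mult_right, rule has_derivative_prod, rule d)
  then have "(\<lambda>\<beta>. \<Sum>p | p permutes UNIV. of_int (sign p) * (\<Prod>r\<in>UNIV. (mat t - magnetic h \<beta>) $ r $ p r)) differentiable (at \<alpha>)"
    by (intro differentiable_sum finite_permutations finite_class.finite_UNIV ballI) (simp only: differentiable_def)
  then show ?thesis
    unfolding det_def differentiable_def .
qed

text \<open>For a hermitian matrix, \<open>re\<close> says that it is real. The smooth function
  \<open>g\<close> then has vanishing derivative along \<open>Asym E\<close>, and the simple
  spectrum transfers the resulting little-o bound from \<open>g\<close> to the eigenvalue.\<close>

lemma magnetic_real_critical:
  fixes h :: "real ^ 'n::finite ^ 'n"
  assumes h: "h \<in> Symm E" and \<alpha>: "\<alpha> \<in> Asym E"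
    and re: "transpose (magnetic h \<alpha>) = magnetic h \<alpha>"
    and simple: "\<And>\<mu>. poly (charpoly (magnetic h \<alpha>)) \<mu> = 0 \<Longrightarrow> order \<mu> (charpoly (magnetic h \<alpha>)) = 1"
    and k: "k \<in> {1..CARD('n)}"
  shows "((\<lambda>\<beta>. lam_class k (gauge_class E (magnetic h \<beta>))) has_derivative (\<lambda>_. 0)) (at \<alpha> within Asym E)"
proof -
  define g where "g = (\<lambda>\<beta>. det (mat (of_real (lam k (magnetic h \<alpha>))) - magnetic h \<beta>))"
  obtain D where D: "(g has_derivative D) (at \<alpha>)"
    unfolding g_def using det_magnetic_differentiable by blast
  interpret D: bounded_linear D
    using D by (rule has_derivative_bounded_linear)
  \<comment> \<open>At a symmetric matrix, transposition reverses the displacement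
    \<open>\<gamma>\<close> and keeps the determinant.\<close>
  have even: "g (\<alpha> - \<gamma>) = g (\<alpha> + \<gamma>)" if \<gamma>: "\<gamma> \<in> Asym E" for \<gamma>
  proof -
    have "magnetic h (\<alpha> - \<gamma>) $ r $ s = magnetic h (\<alpha> + \<gamma>) $ s $ r" for r s
    proof -
      have "magnetic h (\<alpha> - \<gamma>) $ r $ s = exp (- \<i> * of_real (\<gamma> $ r $ s)) * magnetic h \<alpha> $ r $ s"
        by (simp add: magnetic_def right_diff_distrib exp_diff exp_minus field_simps)
      also have "magnetic h \<alpha> $ r $ s = magnetic h \<alpha> $ s $ r"
        using re by (simp add: transpose_def vec_eq_iff)
      also have "exp (- \<i> * of_real (\<gamma> $ r $ s)) = exp (\<i> * of_real (\<gamma> $ s $ r))"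
        by (simp add: Asym_antisym[OF \<gamma>, of s r])
      also have "\<dots> * magnetic h \<alpha> $ s $ r = magnetic h (\<alpha> + \<gamma>) $ s $ r"
        by (simp add: magnetic_def distrib_left exp_add)
      finally show ?thesis .
    qed
    then have "mat t - magnetic h (\<alpha> - \<gamma>) = transpose (mat t - magnetic h (\<alpha> + \<gamma>))" for t
      by (simp add: vec_eq_iff transpose_def mat_def)
    then show ?thesis
      by (simp add: g_def)
  qed
  have D0: "D \<gamma> = 0" if \<gamma>: "\<gamma> \<in> Asym E" for \<gamma>
  proof -
    have 1: "((\<lambda>t. g (\<alpha> + (c * t) *\<^sub>R \<gamma>)) has_derivative (\<lambda>t. D ((c * t) *\<^sub>R \<gamma>))) (at 0)" for c :: real
    proof -
      have "((\<lambda>t. \<alpha> + (c * t) *\<^sub>R \<gamma>) has_derivative (\<lambda>t. (c * t) *\<^sub>R \<gamma>)) (at 0)"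
        by (auto intro!: derivative_eq_intros)
      from has_derivative_compose[OF this, of g D] show ?thesis
        using D by simp
    qed
    have "(t *\<^sub>R \<gamma>) \<in> Asym E" for t
      using Asym_lincomb[OF \<gamma> \<gamma>, of t 0] by simp
    then have "g (\<alpha> + (- 1 * t) *\<^sub>R \<gamma>) = g (\<alpha> + (1 * t) *\<^sub>R \<gamma>)" for t
      using even[of "t *\<^sub>R \<gamma>"] by simp
    \<comment> \<open>The curves in the directions \<open>\<gamma>\<close> and
      \<open>- \<gamma>\<close> give the same function of \<open>t\<close>, so by uniqueness their
      derivatives agree.\<close>
    then have "(\<lambda>t. D ((- 1 * t) *\<^sub>R \<gamma>)) = (\<lambda>t. D ((1 * t) *\<^sub>R \<gamma>))"
      using 1[of "- 1"] 1[of 1] by (intro has_derivative_unique[of _ _ 0]) simp_all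
    from fun_cong[OF this, of 1] have "- D \<gamma> = D \<gamma>"
      by (simp add: D.neg)
    then show ?thesis by simp
  qed
  have "((\<lambda>\<beta>. det (mat t - magnetic h \<beta>)) \<longlongrightarrow> det (mat t - magnetic h \<alpha>)) (at \<alpha> within Asym E)" for t
    using det_magnetic_differentiable[of t h \<alpha>] has_derivative_at_withinI has_derivative_continuous
    by (metis continuous_within)
  from simple_spectrum_lam_bound[where M = "magnetic h", OF hermitian_magnetic[OF h] \<alpha> this simple k]
  obtain c where c: "c > 0" and ev: "\<forall>\<^sub>F \<beta> in at \<alpha> within Asym E.
      c * \<bar>lam k (magnetic h \<beta>) - lam k (magnetic h \<alpha>)\<bar> \<le> cmod (g \<beta>)"
    unfolding g_def by blast
  have g\<alpha>: "g \<alpha> = 0"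
    using hermitian_lam_root[OF hermitian_magnetic[OF h \<alpha>] k] by (simp add: g_def poly_charpoly)
  have in_A: "\<forall>\<^sub>F \<beta> in at \<alpha> within Asym E. \<beta> \<in> Asym E"
    by (simp add: eventually_at_filter)
  have L: "lam_class k (gauge_class E (magnetic h \<beta>)) = lam k (magnetic h \<beta>)" if "\<beta> \<in> Asym E" for \<beta>
    using lam_class_gauge_class magnetic_in_Herm h that by blast
  have "((\<lambda>\<beta>. (1 / norm (\<beta> - \<alpha>)) *\<^sub>R (g \<beta> - (g \<alpha> + D (\<beta> - \<alpha>)))) \<longlongrightarrow> 0) (at \<alpha> within Asym E)"
    using has_derivative_at_withinI[OF D] unfolding has_derivative_within by blast
  then have "((\<lambda>\<beta>. (1 / c) *\<^sub>R norm ((1 / norm (\<beta> - \<alpha>)) *\<^sub>R (g \<beta> - (g \<alpha> + D (\<beta> - \<alpha>))))) \<longlongrightarrow> (1 / c) *\<^sub>R norm (0::complex)) (at \<alpha> within Asym E)"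
    by (intro tendsto_intros)
  then have lim: "((\<lambda>\<beta>. norm ((1 / norm (\<beta> - \<alpha>)) *\<^sub>R (g \<beta> - (g \<alpha> + D (\<beta> - \<alpha>)))) / c) \<longlongrightarrow> 0) (at \<alpha> within Asym E)"
    by (simp add: mult.commute)
  have "((\<lambda>\<beta>. (1 / norm (\<beta> - \<alpha>)) *\<^sub>R (lam_class k (gauge_class E (magnetic h \<beta>)) -
      (lam_class k (gauge_class E (magnetic h \<alpha>)) + 0))) \<longlongrightarrow> 0) (at \<alpha> within Asym E)"
  \<comment> \<open>On \<open>Asym E\<close> both \<open>g \<alpha>\<close> and the linear term
    vanish, so the remainder of \<open>g\<close> is \<open>g \<beta>\<close> itself, which bounds
    \<open>c\<close> times the displacement of the eigenvalue.\<close>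
  proof (rule Lim_null_comparison[OF _ lim])
    show "\<forall>\<^sub>F \<beta> in at \<alpha> within Asym E. norm ((1 / norm (\<beta> - \<alpha>)) *\<^sub>R (lam_class k (gauge_class E (magnetic h \<beta>)) -
      (lam_class k (gauge_class E (magnetic h \<alpha>)) + 0)))
      \<le> norm ((1 / norm (\<beta> - \<alpha>)) *\<^sub>R (g \<beta> - (g \<alpha> + D (\<beta> - \<alpha>)))) / c"
      using ev in_A
    proof eventually_elim
      case (elim \<beta>)
      have "\<beta> - \<alpha> \<in> Asym E"
        using Asym_lincomb[OF elim(2) \<alpha>, of 1 "- 1"] by simp
      then have "D (\<beta> - \<alpha>) = 0" by (rule D0)
      moreover have "\<bar>lam k (magnetic h \<beta>) - lam k (magnetic h \<alpha>)\<bar> \<le> cmod (g \<beta>) / c"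
        using elim(1) c by (simp add: pos_le_divide_eq mult.commute)
      from mult_left_mono[OF this, of "1 / norm (\<beta> - \<alpha>)"]
      have "1 / norm (\<beta> - \<alpha>) * \<bar>lam k (magnetic h \<beta>) - lam k (magnetic h \<alpha>)\<bar> \<le> 1 / norm (\<beta> - \<alpha>) * (cmod (g \<beta>) / c)"
        by simp
      ultimately show ?case
        by (simp add: L elim(2) \<alpha> g\<alpha>)
    qed
  qed
  then show ?thesis
    unfolding has_derivative_within by simp
qed

section \<open>Graphs with disjoint cycles and generic matrices\<close>

text \<open>A path is grown at its front and every loop is cut as it arises. The last clause
  confines the path to \<open>J\<close> when \<open>R\<close> is \<open>Restr E J\<close> and
  \<open>x\<close> lies in \<open>J\<close>.\<close>

lemma distinct_path_exists:
  assumes "(x, y) \<in> R\<^sup>*"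
  shows "\<exists>p. p \<noteq> [] \<and> hd p = x \<and> last p = y \<and> distinct p \<and> successively (\<lambda>a b. (a, b) \<in> R) p
    \<and> set p \<subseteq> insert x (Range R)"
  using assms
proof (induction rule: converse_rtrancl_induct)
  case base
  then show ?case by (intro exI[of _ "[y]"]) simp
next
  case (step x z)
  then obtain p where p: "p \<noteq> []" "hd p = z" "last p = y" "distinct p"
    "successively (\<lambda>a b. (a, b) \<in> R) p" "set p \<subseteq> insert z (Range R)" by blast
  show ?case
  proof (cases "x \<in> set p")
    case True
    \<comment> \<open>The new first vertex already occurs, so the path restarts from that
      occurrence.\<close>
    then obtain as bs where "p = as @ x # bs" by (meson split_list)
    then show ?thesis
      using p step(1) by (intro exI[of _ "x # bs"]) (auto simp: successively_append_iff)
  next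
    case False
    then show ?thesis
      using p step(1) by (intro exI[of _ "x # p"]) (auto simp: successively_Cons)
  qed
qed

text \<open>A simple path inside \<open>J\<close> from \<open>a\<close> to \<open>b\<close> is
  closed up through \<open>r\<close>. The third conclusion lists the cycle edges at
  \<open>r\<close>, which makes it possible to tell such cycles apart by their edge sets.\<close>

lemma cycle_through_vertex:
  assumes sym: "sym E" and conn: "\<forall>x\<in>J. \<forall>y\<in>J. (x, y) \<in> (Restr E J)\<^sup>*"
    and r: "r \<notin> J" "a \<in> J" "b \<in> J" "a \<noteq> b" "(r, a) \<in> E" "(r, b) \<in> E"
  obtains c where "simple_cycle E c" "r \<in> set c" "\<And>x. {r, x} \<in> cycle_edges c \<longleftrightarrow> x = a \<or> x = b"
proof -
  obtain p where p: "p \<noteq> []" "hd p = a" "last p = b" "distinct p"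
    "successively (\<lambda>a b. (a, b) \<in> Restr E J) p" "set p \<subseteq> insert a (Range (Restr E J))"
    using distinct_path_exists[OF conn[rule_format, OF r(2,3)]] by (elim exE conjE)
  define m where "m = length p"
  have m: "2 \<le> m"
    using p(1-3) r(4) unfolding m_def by (cases p rule: remdups_adj.cases) auto
  have pJ: "set p \<subseteq> J" using p(6) r by auto
  have pr: "p ! i \<noteq> r" if "i < m" for i
    using pJ r(1) nth_mem[of i p] that unfolding m_def by blast
  have p0: "p ! 0 = a" and pm: "p ! (m - 1) = b"
    using p by (auto simp: m_def hd_conv_nth last_conv_nth)
  have edge: "(p ! i, p ! Suc i) \<in> E" if "Suc i < m" for i
    using successively_nth[OF p(5), of i] that by (auto simp: m_def)
  define c where "c = r # p"
  have len: "length c = Suc m" by (simp add: c_def m_def)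
  \<comment> \<open>Prepending \<open>r\<close> shifts the indices by one: the successor of position
    \<open>i\<close> is \<open>p ! i\<close>, except that the last position \<open>m\<close> wraps
    around to \<open>r\<close>.\<close>
  have next_vertex: "c ! (Suc i mod length c) = (if i = m then r else p ! i)" if "i < Suc m" for i
    unfolding len using that by (cases "i = m") (auto simp: c_def)
  have "(c ! i, c ! (Suc i mod length c)) \<in> E" if "i < Suc m" for i
    unfolding next_vertex[OF that]
  proof (cases i)
    case 0
    then show "(c ! i, if i = m then r else p ! i) \<in> E"
      using m p0 r by (auto simp: c_def)
  next
    case (Suc j)
    then show "(c ! i, if i = m then r else p ! i) \<in> E"
      using edge[of j] that m pm r sym by (auto simp: c_def dest: symD)
  qed
  then have "simple_cycle E c"
    unfolding simple_cycle_def len using m p(4) pJ r(1) by (auto simp: c_def)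
  moreover have "{r, x} \<in> cycle_edges c \<longleftrightarrow> x = a \<or> x = b" for x
  proof
    assume "{r, x} \<in> cycle_edges c"
    then obtain i where i: "i < Suc m" "{r, x} = {c ! i, if i = m then r else p ! i}"
      unfolding cycle_edges_def len using next_vertex unfolding len by auto
    show "x = a \<or> x = b"
    proof (cases i)
      case 0
      then show ?thesis using i m p0 pr[of 0] by (auto simp: c_def doubleton_eq_iff)
    next
      case (Suc j)
      then show ?thesis
        using i m pm pr[of j] pr[of i] by (cases "i = m") (auto simp: c_def doubleton_eq_iff)
    qed
  next
    assume "x = a \<or> x = b"
    then show "{r, x} \<in> cycle_edges c"
    proof
      assume "x = a"
      then have "{r, x} = {c ! 0, c ! (Suc 0 mod length c)}"
        using next_vertex[of 0] m p0 by (simp add: c_def)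
      then show ?thesis unfolding cycle_edges_def len by (intro image_eqI[of _ _ 0]) (auto simp: len)
    next
      assume "x = b"
      then have "{r, x} = {c ! m, c ! (Suc m mod length c)}"
        using next_vertex[of m] m pm by (auto simp: c_def nth_Cons')
      then show ?thesis unfolding cycle_edges_def len by (intro image_eqI[of _ _ m]) (auto simp: len)
    qed
  qed
  ultimately show ?thesis
    using that by (auto simp: c_def)
qed

text \<open>A third neighbour \<open>c\<close> would give one cycle through \<open>r\<close> using
  \<open>a\<close> and \<open>b\<close> and another using \<open>a\<close> and \<open>c\<close>. The
  edge from \<open>r\<close> to \<open>c\<close> lies on only one of them, yet they share
  \<open>r\<close>.\<close>

lemma disjoint_cycles_two_neighbours:
  assumes "sym E" "disjoint_cycles E" "\<forall>x\<in>J. \<forall>y\<in>J. (x, y) \<in> (Restr E J)\<^sup>*"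
    and "r \<notin> J" "a \<in> J" "b \<in> J" "a \<noteq> b" "(r, a) \<in> E" "(r, b) \<in> E"
    and "c \<in> J" "(r, c) \<in> E"
  shows "c = a \<or> c = b"
proof (rule ccontr)
  assume n: "\<not> ?thesis"
  obtain p where p: "simple_cycle E p" "r \<in> set p" "\<And>x. {r, x} \<in> cycle_edges p \<longleftrightarrow> x = a \<or> x = b"
    using cycle_through_vertex[OF assms(1,3,4,5,6,7,8,9)] by metis
  obtain q where q: "simple_cycle E q" "r \<in> set q" "\<And>x. {r, x} \<in> cycle_edges q \<longleftrightarrow> x = a \<or> x = c"
    using cycle_through_vertex[OF assms(1,3,4,5,10) _ assms(8,11)] n by metis
  have "cycle_edges p \<noteq> cycle_edges q"
    using p(3)[of c] q(3)[of c] n by auto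
  then show False
    using assms(2) p q unfolding disjoint_cycles_def by blast
qed

section \<open>Eigenvectors with real currents vanish nowhere\<close>

lemma rtrancl_exit:
  assumes "(x, y) \<in> R\<^sup>*" "x \<in> J" "y \<notin> J"
  obtains a b where "(a, b) \<in> R" "a \<in> J" "b \<notin> J"
  using assms by (induction rule: rtrancl_induct) blast+

lemma components_eq: "components E J = {(Restr E J)\<^sup>* `` {x} |x. x \<in> J}"
  unfolding components_def quotient_def by auto

lemma generic_eigenvectorD:
  assumes "generic E h" "signing (principal_submatrix J h) h'" "eigenvector_on J (cmat h') x"
  shows "\<exists>!C. C \<in> components E J \<and> (\<forall>r\<in>C. x $ r \<noteq> 0)"
  using assms unfolding generic_def by blast

text \<open>Conjugation by the phases of \<open>\<psi>\<close> changes no moduli and makes the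
  entries real. Since \<open>sgn 0 = 0\<close>, it also clears all rows and columns outside the
  support of \<open>\<psi>\<close>, as the encoding of principal submatrices requires.\<close>

lemma gauge_real_signing:
  fixes A :: "complex ^ 'n::finite ^ 'n" and \<psi> :: "complex ^ 'n"
  assumes A: "hermitian A" "\<And>r s. cmod (A $ r $ s) = \<bar>h $ r $ s\<bar>" "\<And>r. A $ r $ r = of_real (h $ r $ r)"
    and Im: "\<And>r s. Im (cnj (\<psi> $ r) * A $ r $ s * \<psi> $ s) = 0"
  defines "h' \<equiv> (\<chi> r s. Re (cnj (sgn (\<psi> $ r)) * A $ r $ s * sgn (\<psi> $ s)))"
  shows "complex_of_real (h' $ r $ s) = cnj (sgn (\<psi> $ r)) * A $ r $ s * sgn (\<psi> $ s)" (is ?t1)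
    and "signing (principal_submatrix {r. \<psi> $ r \<noteq> 0} h) h'" (is ?t2)
proof -
  have e: "complex_of_real (h' $ r $ s) = cnj (sgn (\<psi> $ r)) * A $ r $ s * sgn (\<psi> $ s)" for r s
  proof -
    \<comment> \<open>Division by zero yields 0, so the identity also covers coordinates where
      \<open>\<psi>\<close> vanishes.\<close>
    have "cnj (sgn (\<psi> $ r)) * A $ r $ s * sgn (\<psi> $ s) =
        (cnj (\<psi> $ r) * A $ r $ s * \<psi> $ s) / of_real (cmod (\<psi> $ r) * cmod (\<psi> $ s))"
      by (simp add: sgn_eq)
    then have "Im (cnj (sgn (\<psi> $ r)) * A $ r $ s * sgn (\<psi> $ s)) = 0"
      using Im[of r s] by (simp only: Im_divide_of_real div_0)
    then show ?thesis
      by (simp add: h'_def complex_eq_iff)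
  qed
  then show ?t1 .
  have "h' $ s $ r = h' $ r $ s" for r s
  proof -
    have "complex_of_real (h' $ s $ r) = cnj (complex_of_real (h' $ r $ s))"
      using A(1)[unfolded hermitian_def, rule_format, of r s] unfolding e
      by (simp add: mult.commute mult.left_commute)
    then show ?thesis by (simp only: complex_cnj_complex_of_real of_real_eq_iff)
  qed
  moreover have "h' $ r $ s = h $ r $ s \<or> h' $ r $ s = - h $ r $ s" if "\<psi> $ r \<noteq> 0" "\<psi> $ s \<noteq> 0" for r s
  proof -
    have "\<bar>h' $ r $ s\<bar> = cmod (complex_of_real (h' $ r $ s))" by simp
    also have "\<dots> = \<bar>h $ r $ s\<bar>"
      unfolding e using that by (simp add: norm_mult norm_sgn A(2))
    finally show ?thesis by (auto simp: abs_if split: if_splits)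
  qed
  moreover have "h' $ r $ r = h $ r $ r" if "\<psi> $ r \<noteq> 0" for r
  proof -
    have "cnj (sgn (\<psi> $ r)) * sgn (\<psi> $ r) = 1"
      using that by (metis complex_norm_square mult.commute norm_sgn one_power2 of_real_1 of_real_power)
    then have "complex_of_real (h' $ r $ r) = of_real (h $ r $ r)"
      unfolding e A(3) by (metis mult.assoc mult.commute mult_1)
    then show ?thesis by simp
  qed
  moreover have "h' $ r $ s = 0" if "\<psi> $ r = 0 \<or> \<psi> $ s = 0" for r s
    using that by (auto simp: h'_def)
  ultimately show ?t2
    unfolding signing_def principal_submatrix_def transpose_def
    by (auto simp: vec_eq_iff)
qed

text \<open>Genericity enters twice: for the support \<open>J\<close> of \<open>\<psi>\<close>,
  where it gives connectedness, and for \<open>J\<close> enlarged by one vertex, where it gives the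
  contradiction.\<close>

lemma generic_critical_eigenvector_nonzero:
  fixes A :: "complex ^ 'n::finite ^ 'n" and \<psi> :: "complex ^ 'n"
  assumes E: "simple_graph E" "connected_graph E" "disjoint_cycles E"
    and h: "h \<in> Symm E" "generic E h"
    and A: "hermitian A" "\<And>r s. cmod (A $ r $ s) = \<bar>h $ r $ s\<bar>" "\<And>r. A $ r $ r = of_real (h $ r $ r)"
    and \<psi>: "\<psi> \<noteq> 0" "\<And>r. (\<Sum>s\<in>UNIV. A $ r $ s * \<psi> $ s) = \<mu> * \<psi> $ r"
    and Im: "\<And>r s. Im (cnj (\<psi> $ r) * A $ r $ s * \<psi> $ s) = 0"
  shows "\<psi> $ r \<noteq> 0"
proof -
  define J where "J = {r. \<psi> $ r \<noteq> 0}"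
  \<comment> \<open>The vector \<open>\<psi>\<close> with its phases removed; it is an eigenvector
    of the signing \<open>h'\<close> on \<open>J\<close>.\<close>
  define x :: "complex ^ 'n" where "x = (\<chi> r. of_real (cmod (\<psi> $ r)))"
  define h' where "h' = (\<chi> r s. Re (cnj (sgn (\<psi> $ r)) * A $ r $ s * sgn (\<psi> $ s)))"
  have e: "complex_of_real (h' $ r $ s) = cnj (sgn (\<psi> $ r)) * A $ r $ s * sgn (\<psi> $ s)" for r s
    unfolding h'_def by (rule gauge_real_signing(1)[OF A Im])
  have sig: "signing (principal_submatrix J h) h'"
    unfolding h'_def J_def by (rule gauge_real_signing(2)[OF A Im])
  have hs: "h $ s $ r = h $ r $ s" for r s
    using h(1) by (rule Symm_sym)
  have h's: "h' $ s $ r = h' $ r $ s" for r s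
    using sig unfolding signing_def transpose_def vec_eq_iff vec_lambda_beta by blast
  have strict: "h $ r $ s \<noteq> 0 \<longleftrightarrow> (r, s) \<in> E" if "r \<noteq> s" for r s
    using h(2) that unfolding generic_def strictly_supported_def by blast
  have symE: "sym E" using E(1) unfolding simple_graph_def by blast
  have x0: "x \<noteq> 0" and xJ: "x $ r = 0 \<longleftrightarrow> r \<notin> J" for r
    using \<psi>(1) by (auto simp: x_def J_def vec_eq_iff)
  have sgnx: "sgn (\<psi> $ s) * x $ s = \<psi> $ s" for s
    by (auto simp: x_def sgn_eq)
  have cx: "cnj (sgn (\<psi> $ r)) * \<psi> $ r = x $ r" for r
    using complex_norm_square[of "\<psi> $ r"]
    by (cases "\<psi> $ r = 0") (simp_all add: x_def sgn_eq field_simps power2_eq_square)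
  have sumJ: "(\<Sum>s\<in>J. f s * \<psi> $ s) = (\<Sum>s\<in>UNIV. f s * \<psi> $ s)" for f :: "'n \<Rightarrow> complex"
    by (rule sum.mono_neutral_left) (auto simp: J_def)
  have eig: "(\<Sum>s\<in>J. cmat h' $ r $ s * x $ s) = \<mu> * x $ r" for r
  proof -
    have "(\<Sum>s\<in>J. cmat h' $ r $ s * x $ s) = (\<Sum>s\<in>J. (cnj (sgn (\<psi> $ r)) * A $ r $ s) * \<psi> $ s)"
      unfolding cmat_def vec_lambda_beta e by (simp only: mult.assoc sgnx)
    also have "\<dots> = cnj (sgn (\<psi> $ r)) * (\<Sum>s\<in>UNIV. A $ r $ s * \<psi> $ s)"
      unfolding sumJ by (simp add: sum_distrib_left mult.assoc)
    also have "\<dots> = \<mu> * (cnj (sgn (\<psi> $ r)) * \<psi> $ r)"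
      unfolding \<psi>(2) by (rule mult.left_commute)
    finally show ?thesis unfolding cx .
  qed
  have "eigenvector_on J (cmat h') x"
    unfolding eigenvector_on_def using x0 xJ eig by blast
  from generic_eigenvectorD[OF h(2) sig this]
  have uniq: "\<exists>!C. C \<in> components E J \<and> (\<forall>r\<in>C. x $ r \<noteq> 0)" .
  have comp: "(Restr E J)\<^sup>* `` {y} \<subseteq> J" if "y \<in> J" for y
  proof
    fix z assume "z \<in> (Restr E J)\<^sup>* `` {y}"
    then have "(y, z) \<in> (Restr E J)\<^sup>*" by blast
    then show "z \<in> J" using that by (induction rule: rtrancl_induct) auto
  qed
  \<comment> \<open>On every component of \<open>J\<close> the vector \<open>x\<close> vanishes
    nowhere, so uniqueness leaves room for one component only.\<close>
  have conn: "\<forall>y\<in>J. \<forall>z\<in>J. (y, z) \<in> (Restr E J)\<^sup>*"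
  proof (intro ballI)
    fix y z assume yz: "y \<in> J" "z \<in> J"
    have "(Restr E J)\<^sup>* `` {w} \<in> components E J \<and> (\<forall>r\<in>(Restr E J)\<^sup>* `` {w}. x $ r \<noteq> 0)" if "w \<in> J" for w
      using comp[OF that] that unfolding components_eq xJ by blast
    from ex1E[OF uniq] this[OF yz(1)] this[OF yz(2)]
    have "(Restr E J)\<^sup>* `` {y} = (Restr E J)\<^sup>* `` {z}"
      by metis
    then show "(y, z) \<in> (Restr E J)\<^sup>*" by blast
  qed
  have "r \<in> J" for r
  proof (rule ccontr)
    assume "r \<notin> J"
    moreover obtain y where "y \<in> J" using \<psi>(1) by (auto simp: J_def vec_eq_iff)
    ultimately obtain a b where ab: "(a, b) \<in> E" "a \<in> J" "b \<notin> J"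
      using rtrancl_exit E(2) unfolding connected_graph_def by metis
    have ba: "(b, a) \<in> E" "b \<noteq> a" using ab symE by (auto dest: symD)
    have hba: "h $ b $ a \<noteq> 0" using strict ba by metis
    \<comment> \<open>Row \<open>b\<close> of the eigenvalue equation, whose right-hand side
      vanishes because \<open>b\<close> is outside the support. A single nonzero term could not
      cancel, so a second neighbour \<open>c\<close> exists.\<close>
    have "(\<Sum>s\<in>J. A $ b $ s * \<psi> $ s) = 0"
      unfolding sumJ \<psi>(2) using ab by (simp add: J_def)
    then have sum0: "A $ b $ a * \<psi> $ a + (\<Sum>s\<in>J - {a}. A $ b $ s * \<psi> $ s) = 0"
      using ab by (simp add: sum.remove)
    have Aba: "A $ b $ a * \<psi> $ a \<noteq> 0"
      using A(2)[of b a] hba ab by (auto simp: J_def)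
    have "\<exists>c\<in>J - {a}. A $ b $ c * \<psi> $ c \<noteq> 0"
      using sum0 Aba by (metis (no_types, lifting) add.right_neutral sum.neutral)
    then obtain c where c: "c \<in> J" "c \<noteq> a" "A $ b $ c \<noteq> 0" by auto
    have "b \<noteq> c" using ab c by blast
    then have bc: "(b, c) \<in> E" "h $ b $ c \<noteq> 0"
      using c(3) A(2)[of b c] strict[of b c] by auto
    have only: "h $ b $ s = 0" if "s \<in> J" "s \<noteq> a" "s \<noteq> c" for s
      using disjoint_cycles_two_neighbours[OF symE E(3) conn ab(3) ab(2) c(1) c(2)[symmetric] ba(1) bc(1) that(1)]
        that strict[of b s] ab by metis
    have "(\<Sum>s\<in>J - {a}. A $ b $ s * \<psi> $ s) = (\<Sum>s\<in>{c}. A $ b $ s * \<psi> $ s)"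
      using c only A(2) by (intro sum.mono_neutral_right) (auto, metis abs_zero norm_eq_zero)
    with sum0 have "A $ b $ a * \<psi> $ a = - (A $ b $ c * \<psi> $ c)"
      by (simp add: eq_neg_iff_add_eq_0)
    from arg_cong[OF this, of cmod]
    have abs: "\<bar>h $ b $ a * cmod (\<psi> $ a)\<bar> = \<bar>h $ b $ c * cmod (\<psi> $ c)\<bar>"
      by (simp add: norm_mult A(2) abs_mult)
    \<comment> \<open>The two products have equal absolute value, so a relative sign
      \<open>\<tau>\<close> makes them cancel without the phases of \<open>A\<close> and
      \<open>\<psi>\<close>.\<close>
    define \<tau> :: real where "\<tau> = (if h $ b $ a * cmod (\<psi> $ a) = h $ b $ c * cmod (\<psi> $ c) then - 1 else 1)"
    have \<tau>: "h $ b $ a * cmod (\<psi> $ a) + \<tau> * h $ b $ c * cmod (\<psi> $ c) = 0" "\<tau> = 1 \<or> \<tau> = - 1"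
      using abs by (auto simp: \<tau>_def abs_eq_iff)
    define g where "g = (\<lambda>s. if s = a then h $ b $ a else if s = c then \<tau> * h $ b $ c else 0)"
    define J' where "J' = insert b J"
    \<comment> \<open>\<open>h'\<close> bordered by row and column \<open>b\<close>: the entry at
      \<open>a\<close> is that of \<open>h\<close>, the one at \<open>c\<close> carries the sign
      \<open>\<tau>\<close>. As \<open>x\<close> vanishes at \<open>b\<close>, the old rows still
      satisfy their equations.\<close>
    define h2 where "h2 = (\<chi> r s. if r = b then (if s = b then h $ b $ b else g s) else if s = b then g r else h' $ r $ s)"
    have sig0: "h' $ r $ r = principal_submatrix J h $ r $ r"
      "r \<noteq> s \<Longrightarrow> h' $ r $ s = principal_submatrix J h $ r $ s \<or> h' $ r $ s = - principal_submatrix J h $ r $ s" for r s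
      using sig unfolding signing_def by blast+
    have g: "g s = principal_submatrix J' h $ b $ s \<or> g s = - principal_submatrix J' h $ b $ s" if "s \<noteq> b" for s
      using only[of s] ab c \<tau>(2) that by (auto simp: g_def principal_submatrix_def J'_def)
    have ps: "principal_submatrix J' h $ s $ r = principal_submatrix J' h $ r $ s" for r s
      using hs[of r s] by (simp add: principal_submatrix_def)
    have pJ: "principal_submatrix J' h $ r $ s = principal_submatrix J h $ r $ s" if "r \<noteq> b" "s \<noteq> b" for r s
      using that by (simp add: principal_submatrix_def J'_def)
    have "signing (principal_submatrix J' h) h2"
      unfolding signing_def
    proof (intro conjI allI impI)
      have "h2 $ s $ r = h2 $ r $ s" for r s
        using h's[of r s] by (simp add: h2_def)
      then show "transpose h2 = h2"
        unfolding transpose_def vec_eq_iff vec_lambda_beta by blast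
      show "h2 $ r $ r = principal_submatrix J' h $ r $ r" for r
        using sig0(1)[of r] pJ[of r r] by (cases "r = b") (simp_all add: h2_def principal_submatrix_def J'_def)
      show "h2 $ r $ s = principal_submatrix J' h $ r $ s \<or> h2 $ r $ s = - principal_submatrix J' h $ r $ s"
        if "r \<noteq> s" for r s
        using sig0(2)[OF that] pJ[of r s] g[of s] g[of r] ps[of r b] that
        by (cases "r = b"; cases "s = b") (simp_all add: h2_def)
    qed
    moreover have "(\<Sum>s\<in>J'. cmat h2 $ r $ s * x $ s) = \<mu> * x $ r" if "r \<in> J'" for r
    proof -
      have "(\<Sum>s\<in>J'. cmat h2 $ r $ s * x $ s) = (\<Sum>s\<in>J. cmat h2 $ r $ s * x $ s)"
        using xJ[of b] ab by (simp add: J'_def)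
      also have "\<dots> = \<mu> * x $ r"
      proof (cases "r = b")
        case True
        have "(\<Sum>s\<in>J. cmat h2 $ r $ s * x $ s) = (\<Sum>s\<in>{a, c}. cmat h2 $ r $ s * x $ s)"
          using True ab c by (intro sum.mono_neutral_right) (auto simp: cmat_def h2_def g_def)
        also have "\<dots> = of_real (h $ b $ a * cmod (\<psi> $ a) + \<tau> * h $ b $ c * cmod (\<psi> $ c))"
          using True c ab by (auto simp: cmat_def h2_def g_def x_def)
        finally show ?thesis using True xJ[of b] ab \<tau>(1) by simp
      next
        case False
        have "(\<Sum>s\<in>J. cmat h2 $ r $ s * x $ s) = (\<Sum>s\<in>J. cmat h' $ r $ s * x $ s)"
          using False ab by (intro sum.cong refl) (auto simp: cmat_def h2_def)
        then show ?thesis using eig by simp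
      qed
      finally show ?thesis .
    qed
    then have "eigenvector_on J' (cmat h2) x"
      unfolding eigenvector_on_def using x0 xJ by (auto simp: J'_def)
    ultimately have "\<exists>!C. C \<in> components E J' \<and> (\<forall>r\<in>C. x $ r \<noteq> 0)"
      using generic_eigenvectorD[OF h(2)] by blast
    then obtain y where y: "y \<in> J'" "\<forall>r \<in> (Restr E J')\<^sup>* `` {y}. x $ r \<noteq> 0"
      unfolding components_eq by blast
    \<comment> \<open>The edge between \<open>a\<close> and \<open>b\<close> attaches
      \<open>b\<close> to the connected set \<open>J\<close>, so the component of \<open>y\<close>
      contains the zero \<open>b\<close> of \<open>x\<close>.\<close>
    have "(y, b) \<in> (Restr E J')\<^sup>*"
    proof (cases "y = b")
      case False
      then have "(y, a) \<in> (Restr E J)\<^sup>*" using conn y ab by (auto simp: J'_def)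
      moreover have "Restr E J \<subseteq> Restr E J'" by (auto simp: J'_def)
      ultimately have "(y, a) \<in> (Restr E J')\<^sup>*" using rtrancl_mono by blast
      moreover have "(a, b) \<in> Restr E J'" using ab by (auto simp: J'_def)
      ultimately show ?thesis by (rule rtrancl_into_rtrancl)
    qed simp
    then have "x $ b \<noteq> 0" using y by blast
    then show False using xJ ab by blast
  qed
  then show ?thesis by (auto simp: J_def)
qed

section \<open>Critical points are signings\<close>

lemma sum_single_entry:
  fixes F :: "'n::finite \<Rightarrow> 'n \<Rightarrow> complex"
  shows "(\<Sum>a\<in>UNIV. \<Sum>b\<in>UNIV. (if a = r \<and> b = s then 1 else 0) * F a b) = F r s"
proof -
  have "(\<Sum>b\<in>UNIV. (if a = r \<and> b = s then 1 else 0) * F a b) = (if a = r then F r s else 0)" for a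
  proof (cases "a = r")
    case True
    then have "(\<Sum>b\<in>UNIV. (if a = r \<and> b = s then 1 else 0) * F a b) = (\<Sum>b\<in>UNIV. if b = s then F r s else 0)"
      by (intro sum.cong refl) simp
    then show ?thesis using True by simp
  qed simp
  then show ?thesis by simp
qed

lemma exp_difference_quotient:
  assumes "t \<longlonglongrightarrow> 0" "\<And>n. t n \<noteq> 0"
  shows "(\<lambda>n. (exp (\<i> * of_real (t n * c)) - 1) / of_real (t n)) \<longlonglongrightarrow> \<i> * of_real c"
proof -
  have "((\<lambda>z. exp (\<i> * of_real c * z)) has_field_derivative \<i> * of_real c) (at 0)"
    by (auto intro!: derivative_eq_intros)
  then have "(\<lambda>z. (exp (\<i> * of_real c * z) - 1) / z) \<midarrow>0\<rightarrow> \<i> * of_real c"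
    by (simp add: DERIV_def)
  moreover have "(\<lambda>n. of_real (t n) :: complex) \<longlonglongrightarrow> 0"
    using tendsto_of_real[OF assms(1)] by simp
  then have "filterlim (\<lambda>n. of_real (t n) :: complex) (at 0) sequentially"
    using assms(2) by (intro filterlim_atI) auto
  ultimately have "(\<lambda>n. (exp (\<i> * of_real c * of_real (t n)) - 1) / of_real (t n)) \<longlonglongrightarrow> \<i> * of_real c"
    by (rule filterlim_compose)
  then show ?thesis by (simp add: mult_ac)
qed

lemma charpoly_root_unit_eigenvector:
  fixes A :: "complex ^ 'n::finite ^ 'n"
  assumes "poly (charpoly A) \<mu> = 0"
  obtains x where "norm x = 1" "\<And>r. (\<Sum>s\<in>UNIV. A $ r $ s * x $ s) = \<mu> * x $ r"
proof -
  obtain x where x: "x \<noteq> 0" "\<And>r. (\<Sum>s\<in>UNIV. A $ r $ s * x $ s) = \<mu> * x $ r"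
    using charpoly_root_eigenvector[OF assms] by blast
  have "sgn x $ s = of_real (inverse (norm x)) * x $ s" for s
    by (simp only: sgn_div_norm vector_scaleR_component) (simp add: scaleR_conv_of_real)
  then have "(\<Sum>s\<in>UNIV. A $ r $ s * sgn x $ s) = of_real (inverse (norm x)) * (\<Sum>s\<in>UNIV. A $ r $ s * x $ s)"
    and "sgn x $ r = of_real (inverse (norm x)) * x $ r" for r
    by (simp_all only: sum_distrib_left mult.left_commute)
  then have "(\<Sum>s\<in>UNIV. A $ r $ s * sgn x $ s) = \<mu> * sgn x $ r" for r
    by (simp only: x(2) mult.left_commute)
  then show ?thesis
    using x(1) by (intro that[of "sgn x"]) (simp_all add: norm_sgn)
qed

text \<open>
  Pairing the eigenvalue equation of \<open>h\<^sub>\<alpha>\<^sub>+\<^sub>t\<^sub>K\<close>, with unit eigenvector \<open>w\<^sub>t\<close>, against \<open>\<psi>\<close>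
  expresses the difference quotient of the eigenvalue by that of the matrix. By compactness \<open>w\<^sub>t\<close>
  converges along a sequence \<open>t \<rightarrow> 0\<close>, and its limit is a multiple of \<open>\<psi>\<close> because the eigenvalue is
  simple; so no differentiability of eigenvectors is needed.
\<close>

lemma critical_direction:
  fixes h :: "real ^ 'n::finite ^ 'n"
  assumes h: "h \<in> Symm E" and \<alpha>: "\<alpha> \<in> Asym E" and K: "K \<in> Asym E" and k: "k \<in> {1..CARD('n)}"
    and der: "((\<lambda>\<beta>. lam k (magnetic h \<beta>)) has_derivative (\<lambda>_. 0)) (at \<alpha> within Asym E)"
    and simple: "order (of_real (lam k (magnetic h \<alpha>))) (charpoly (magnetic h \<alpha>)) = 1"
    and \<psi>: "\<psi> \<noteq> 0" "\<And>r. (\<Sum>s\<in>UNIV. magnetic h \<alpha> $ r $ s * \<psi> $ s) = of_real (lam k (magnetic h \<alpha>)) * \<psi> $ r"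
  shows "(\<Sum>r\<in>UNIV. \<Sum>s\<in>UNIV. of_real (K $ r $ s) * (cnj (\<psi> $ r) * magnetic h \<alpha> $ r $ s * \<psi> $ s)) = 0"
proof -
  define A where "A = (\<lambda>t. magnetic h (\<alpha> + t *\<^sub>R K))"
  define l where "l = (\<lambda>t. lam k (A t))"
  have A0: "A 0 = magnetic h \<alpha>" by (simp add: A_def)
  have inA: "\<alpha> + t *\<^sub>R K \<in> Asym E" for t
    using Asym_lincomb[OF \<alpha> K, of 1 t] by simp
  have herm: "hermitian (A t)" for t
    unfolding A_def by (rule hermitian_magnetic[OF h inA])
  have "((\<lambda>t. \<alpha> + t *\<^sub>R K) has_derivative (\<lambda>t. t *\<^sub>R K)) (at 0)"
    by (auto intro!: derivative_eq_intros)
  \<comment> \<open>The derivative is given only within \<open>Asym E\<close>; the line through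
    \<open>\<alpha>\<close> stays inside, so the chain rule is applied within its range.\<close>
  moreover have "((\<lambda>\<beta>. lam k (magnetic h \<beta>)) has_derivative (\<lambda>_. 0)) (at (\<alpha> + 0 *\<^sub>R K) within range (\<lambda>t. \<alpha> + t *\<^sub>R K))"
    using der inA by (auto intro: has_derivative_subset)
  ultimately have "(l has_derivative (\<lambda>_. 0)) (at 0)"
    unfolding l_def A_def by (rule has_derivative_in_compose)
  then have "(l has_field_derivative 0) (at 0)"
    unfolding has_field_derivative_def by (simp only: lambda_zero)
  then have l_lim: "(\<lambda>t. (l t - l 0) / t) \<midarrow>0\<rightarrow> 0" and l_cont: "isCont l 0"
    by (simp_all only: DERIV_isCont) (simp add: DERIV_def)
  have "poly (charpoly (A t)) (of_real (l t)) = 0" for t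
    unfolding l_def by (rule hermitian_lam_root[OF herm k])
  then have "\<exists>w. norm w = 1 \<and> (\<forall>r. (\<Sum>s\<in>UNIV. A t $ r $ s * w $ s) = of_real (l t) * w $ r)" for t
    using charpoly_root_unit_eigenvector by metis
  then obtain w where w: "\<And>t. norm (w t) = 1"
    "\<And>t r. (\<Sum>s\<in>UNIV. A t $ r $ s * w t $ s) = of_real (l t) * w t $ r"
    by metis
  have "compact (sphere (0 :: complex ^ 'n) 1)" by simp
  moreover have "\<forall>n. w (1 / real (Suc n)) \<in> sphere 0 1" using w(1) by simp
  ultimately obtain v \<rho> where v: "v \<in> sphere 0 1" and \<rho>: "strict_mono (\<rho> :: nat \<Rightarrow> nat)"
    and lim: "((\<lambda>n. w (1 / real (Suc n))) \<circ> \<rho>) \<longlonglongrightarrow> v"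
    unfolding compact_def by meson
  define t where "t = (\<lambda>n. 1 / real (Suc (\<rho> n)))"
  have t0: "t n \<noteq> 0" for n by (simp add: t_def)
  have t: "t \<longlonglongrightarrow> 0"
    using LIMSEQ_subseq_LIMSEQ[OF LIMSEQ_inverse_real_of_nat \<rho>] by (simp add: t_def o_def inverse_eq_divide)
  have wlim: "(\<lambda>n. w (t n) $ r) \<longlonglongrightarrow> v $ r" for r
    using tendsto_vec_nth[OF lim] by (simp add: o_def t_def)
  have tat: "filterlim t (at 0) sequentially"
    using t t0 by (intro filterlim_atI) auto
  have llim: "(\<lambda>n. (l (t n) - l 0) / t n) \<longlonglongrightarrow> 0"
    by (rule filterlim_compose[OF l_lim tat])
  have l0: "(\<lambda>n. l (t n)) \<longlonglongrightarrow> l 0"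
    using isCont_tendsto_compose[OF l_cont t] .
  have Aexp: "A t $ r $ s = exp (\<i> * of_real (t * K $ r $ s)) * A 0 $ r $ s" for t r s
    by (simp add: A_def magnetic_def distrib_left exp_add)
  have Alim: "(\<lambda>n. A (t n) $ r $ s) \<longlonglongrightarrow> A 0 $ r $ s" for r s
  proof -
    have "(\<lambda>n. exp (\<i> * of_real (t n * K $ r $ s)) * A 0 $ r $ s) \<longlonglongrightarrow> exp (\<i> * of_real (0 * K $ r $ s)) * A 0 $ r $ s"
      by (intro tendsto_intros t)
    then show ?thesis
      unfolding Aexp[of "t n" for n] by simp
  qed
  have Adiff: "(\<lambda>n. (A (t n) $ r $ s - A 0 $ r $ s) / of_real (t n)) \<longlonglongrightarrow> \<i> * of_real (K $ r $ s) * A 0 $ r $ s" for r s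
  proof -
    have "(\<lambda>n. (exp (\<i> * of_real (t n * K $ r $ s)) - 1) / of_real (t n) * A 0 $ r $ s) \<longlonglongrightarrow> \<i> * of_real (K $ r $ s) * A 0 $ r $ s"
      by (intro tendsto_intros exp_difference_quotient t t0)
    moreover have "(exp (\<i> * of_real (t n * K $ r $ s)) - 1) / of_real (t n) * A 0 $ r $ s =
        (A (t n) $ r $ s - A 0 $ r $ s) / of_real (t n)" for n
      unfolding Aexp[of "t n"] by (simp add: left_diff_distrib)
    ultimately show ?thesis by (simp only:)
  qed
  have veig: "(\<Sum>s\<in>UNIV. A 0 $ r $ s * v $ s) = of_real (l 0) * v $ r" for r
  proof (rule LIMSEQ_unique)
    show "(\<lambda>n. \<Sum>s\<in>UNIV. A (t n) $ r $ s * w (t n) $ s) \<longlonglongrightarrow> (\<Sum>s\<in>UNIV. A 0 $ r $ s * v $ s)"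
      by (intro tendsto_intros Alim wlim)
    show "(\<lambda>n. \<Sum>s\<in>UNIV. A (t n) $ r $ s * w (t n) $ s) \<longlonglongrightarrow> of_real (l 0) * v $ r"
      unfolding w(2) by (intro tendsto_intros l0 wlim)
  qed
  have eig0: "(\<Sum>s\<in>UNIV. A 0 $ r $ s * \<psi> $ s) = of_real (l 0) * \<psi> $ r" for r
    unfolding l_def A0 by (rule \<psi>(2))
  have simple0: "order (of_real (l 0)) (charpoly (A 0)) = 1"
    using simple by (simp add: l_def A0)
  obtain c where c: "v = c *s \<psi>"
    using simple_root_eigenvector_unique[OF simple0 \<psi>(1) eig0 veig] .
  \<comment> \<open>The limit of unit vectors is a unit vector; this makes the factor
    \<open>c\<close> cancellable at the end.\<close>
  have "v \<noteq> 0" using v by auto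
  then have "c \<noteq> 0" using c by auto
  \<comment> \<open>Self-adjointness moves \<open>A 0\<close> onto \<open>\<psi>\<close>, so both
    eigenvalue equations become multiples of the same pairing of \<open>\<psi>\<close> with
    \<open>w t\<close>.\<close>
  have pair: "(\<Sum>r\<in>UNIV. \<Sum>s\<in>UNIV. cnj (\<psi> $ r) * ((A t $ r $ s - A 0 $ r $ s) / of_real t) * w t $ s) =
      of_real ((l t - l 0) / t) * (\<Sum>r\<in>UNIV. cnj (\<psi> $ r) * w t $ r)" for t
  proof -
    have "(\<Sum>r\<in>UNIV. cnj (\<psi> $ r) * (\<Sum>s\<in>UNIV. A 0 $ r $ s * w t $ s)) = of_real (l 0) * (\<Sum>r\<in>UNIV. cnj (\<psi> $ r) * w t $ r)"
      unfolding hermitian_form[OF herm] eig0 by (simp add: sum_distrib_left mult.assoc)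
    moreover have "(\<Sum>r\<in>UNIV. cnj (\<psi> $ r) * (\<Sum>s\<in>UNIV. A t $ r $ s * w t $ s)) = of_real (l t) * (\<Sum>r\<in>UNIV. cnj (\<psi> $ r) * w t $ r)"
      unfolding w(2) by (simp add: sum_distrib_left mult.left_commute)
    moreover have "(\<Sum>r\<in>UNIV. \<Sum>s\<in>UNIV. cnj (\<psi> $ r) * ((A t $ r $ s - A 0 $ r $ s) / of_real t) * w t $ s) =
      ((\<Sum>r\<in>UNIV. cnj (\<psi> $ r) * (\<Sum>s\<in>UNIV. A t $ r $ s * w t $ s)) - (\<Sum>r\<in>UNIV. cnj (\<psi> $ r) * (\<Sum>s\<in>UNIV. A 0 $ r $ s * w t $ s))) / of_real t"
      unfolding sum_distrib_left sum_subtractf[symmetric] sum_divide_distrib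
      by (intro sum.cong refl) (simp add: diff_divide_distrib algebra_simps)
    ultimately show ?thesis
      by (simp add: left_diff_distrib[symmetric])
  qed
  \<comment> \<open>The two sides of \<open>pair\<close> are passed to the limit along the sequence;
    the right one tends to 0 because the eigenvalue has derivative 0.\<close>
  have "(\<Sum>r\<in>UNIV. \<Sum>s\<in>UNIV. cnj (\<psi> $ r) * (\<i> * of_real (K $ r $ s) * A 0 $ r $ s) * v $ s) =
      of_real 0 * (\<Sum>r\<in>UNIV. cnj (\<psi> $ r) * v $ r)"
  proof (rule LIMSEQ_unique)
    show "(\<lambda>n. \<Sum>r\<in>UNIV. \<Sum>s\<in>UNIV. cnj (\<psi> $ r) * ((A (t n) $ r $ s - A 0 $ r $ s) / of_real (t n)) * w (t n) $ s)
      \<longlonglongrightarrow> (\<Sum>r\<in>UNIV. \<Sum>s\<in>UNIV. cnj (\<psi> $ r) * (\<i> * of_real (K $ r $ s) * A 0 $ r $ s) * v $ s)"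
      by (intro tendsto_sum tendsto_mult tendsto_const Adiff wlim)
    show "(\<lambda>n. \<Sum>r\<in>UNIV. \<Sum>s\<in>UNIV. cnj (\<psi> $ r) * ((A (t n) $ r $ s - A 0 $ r $ s) / of_real (t n)) * w (t n) $ s)
      \<longlonglongrightarrow> of_real 0 * (\<Sum>r\<in>UNIV. cnj (\<psi> $ r) * v $ r)"
      unfolding pair by (intro tendsto_intros llim wlim)
  qed
  moreover have "(\<Sum>r\<in>UNIV. \<Sum>s\<in>UNIV. cnj (\<psi> $ r) * (\<i> * of_real (K $ r $ s) * A 0 $ r $ s) * v $ s) =
    \<i> * c * (\<Sum>r\<in>UNIV. \<Sum>s\<in>UNIV. of_real (K $ r $ s) * (cnj (\<psi> $ r) * A 0 $ r $ s * \<psi> $ s))"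
    unfolding c sum_distrib_left by (intro sum.cong refl) (simp add: mult_ac)
  ultimately show ?thesis
    using \<open>c \<noteq> 0\<close> by (simp add: A0)
qed

text \<open>Criticality is tested edge by edge. On the diagonal and where \<open>h\<close> vanishes
  the expression is real in any case.\<close>

lemma critical_real_current:
  fixes h :: "real ^ 'n::finite ^ 'n"
  assumes h: "h \<in> Symm E" and \<alpha>: "\<alpha> \<in> Asym E" and k: "k \<in> {1..CARD('n)}"
    and der: "((\<lambda>\<beta>. lam k (magnetic h \<beta>)) has_derivative (\<lambda>_. 0)) (at \<alpha> within Asym E)"
    and simple: "order (of_real (lam k (magnetic h \<alpha>))) (charpoly (magnetic h \<alpha>)) = 1"
    and \<psi>: "\<psi> \<noteq> 0" "\<And>r. (\<Sum>s\<in>UNIV. magnetic h \<alpha> $ r $ s * \<psi> $ s) = of_real (lam k (magnetic h \<alpha>)) * \<psi> $ r"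
  shows "Im (cnj (\<psi> $ r) * magnetic h \<alpha> $ r $ s * \<psi> $ s) = 0"
proof -
  let ?A = "magnetic h \<alpha>"
  define F where "F = (\<lambda>r s. cnj (\<psi> $ r) * ?A $ r $ s * \<psi> $ s)"
  have Fc: "F s r = cnj (F r s)"
    using hermitian_magnetic[OF h \<alpha>, unfolded hermitian_def, rule_format, of r s]
    by (simp add: F_def mult_ac)
  have "F r s = cnj (F r s)"
  proof (cases "r = s \<or> h $ r $ s = 0")
    case True
    then show ?thesis
      using Fc by (auto simp: F_def magnetic_def)
  next
    case False
    \<comment> \<open>The elementary antisymmetric matrix of one edge. Along it the first variation
      is \<open>F r s - F s r\<close>, the difference of a number and its conjugate.\<close>
    define K :: "real ^ 'n ^ 'n" where "K = (\<chi> a b. (if a = r \<and> b = s then 1 else 0) - (if a = s \<and> b = r then 1 else 0))"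
    have rs: "(r, s) \<in> E" "(s, r) \<in> E"
      using h False Symm_sym[OF h, of r s] unfolding Symm_def supported_def by auto
    have "(a, b) = (r, s) \<or> (a, b) = (s, r)" if "K $ a $ b \<noteq> 0" for a b
      using that by (auto simp: K_def split: if_splits)
    then have K_supp: "(a, b) \<in> E" if "K $ a $ b \<noteq> 0" for a b
      using rs that by metis
    have "K $ b $ a = - K $ a $ b" for a b
      unfolding K_def vec_lambda_beta minus_diff_eq conj_commute[of "a = _"] ..
    then have "K \<in> Asym E"
      unfolding Asym_iff supported_def by (intro conjI allI impI K_supp)
    from critical_direction[OF h \<alpha> this k der simple \<psi>]
    have "(\<Sum>a\<in>UNIV. \<Sum>b\<in>UNIV. of_real (K $ a $ b) * F a b) = 0"
      unfolding F_def .
    moreover have "of_real (K $ a $ b) * F a b =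
        (if a = r \<and> b = s then 1 else 0) * F a b - (if a = s \<and> b = r then 1 else 0) * F a b" for a b
      unfolding K_def vec_lambda_beta of_real_diff if_distrib[of of_real] of_real_1 of_real_0
      by (rule left_diff_distrib)
    ultimately have "F r s - F s r = 0"
      by (simp only: sum_subtractf sum_single_entry)
    then show ?thesis using Fc by simp
  qed
  from arg_cong[OF this, of Im] have "Im (F r s) = 0" by simp
  then show ?thesis
    by (simp only: F_def)
qed

section \<open>Gauge equivalence and the two inclusions\<close>

lemma gauge_equiv_iff:
  "gauge_equiv A B \<longleftrightarrow> (\<exists>\<theta>. \<forall>r s. B $ r $ s =
     exp (\<i> * of_real (\<theta> $ r)) * A $ r $ s * exp (- (\<i> * of_real (\<theta> $ s))))"
  unfolding gauge_equiv_def vec_eq_iff[of B] vec_eq_iff[of "B $ _"] phase_diag_conj_nth ..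

lemma gauge_equiv_sym:
  assumes "gauge_equiv A B"
  shows "gauge_equiv B A"
proof -
  obtain \<theta> where \<theta>: "\<And>r s. B $ r $ s = exp (\<i> * of_real (\<theta> $ r)) * A $ r $ s * exp (- (\<i> * of_real (\<theta> $ s)))"
    using assms unfolding gauge_equiv_iff by blast
  show ?thesis
    unfolding gauge_equiv_iff by (rule exI[of _ "- \<theta>"]) (simp add: \<theta> exp_minus field_simps)
qed

lemma gauge_equiv_trans:
  assumes "gauge_equiv A B" "gauge_equiv B C"
  shows "gauge_equiv A C"
proof -
  obtain \<theta> where \<theta>: "\<And>r s. B $ r $ s = exp (\<i> * of_real (\<theta> $ r)) * A $ r $ s * exp (- (\<i> * of_real (\<theta> $ s)))"
    using assms(1) unfolding gauge_equiv_iff by blast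
  obtain \<eta> where \<eta>: "\<And>r s. C $ r $ s = exp (\<i> * of_real (\<eta> $ r)) * B $ r $ s * exp (- (\<i> * of_real (\<eta> $ s)))"
    using assms(2) unfolding gauge_equiv_iff by blast
  show ?thesis
    unfolding gauge_equiv_iff
    by (rule exI[of _ "\<theta> + \<eta>"]) (simp add: \<theta> \<eta> distrib_left exp_add exp_diff exp_minus field_simps)
qed

lemma gauge_class_eq: "gauge_equiv A B \<Longrightarrow> gauge_class E A = gauge_class E B"
  unfolding gauge_class_def using gauge_equiv_sym gauge_equiv_trans by blast

lemma mem_gauge_class: "A \<in> Herm E \<Longrightarrow> A \<in> gauge_class E A"
  unfolding gauge_class_def gauge_equiv_iff by (auto intro: exI[of _ 0])

lemma signing_magnetic:
  fixes h :: "real ^ 'n::finite ^ 'n"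
  assumes h: "h \<in> Symm E" and "signing h h'"
  obtains \<alpha> where "\<alpha> \<in> Asym E" "magnetic h \<alpha> = cmat h'"
proof -
  have h's: "h' $ s $ r = h' $ r $ s" for r s
    using assms(2) unfolding signing_def transpose_def vec_eq_iff vec_lambda_beta by blast
  have diag: "h' $ r $ r = h $ r $ r" for r
    using assms(2) unfolding signing_def by blast
  have pm: "h' $ r $ s = - h $ r $ s" if "h' $ r $ s \<noteq> h $ r $ s" for r s
    using assms(2) diag that unfolding signing_def by metis
  obtain f :: "'n \<Rightarrow> nat" where f: "inj f"
    using finite_imp_inj_to_nat_seg[OF finite_class.finite_UNIV] by blast
  \<comment> \<open>Phases \<open>pi\<close> and \<open>- pi\<close> both give the sign -1, but
    antisymmetry needs opposite values in the two directions of an edge; the injection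
    \<open>f\<close> chooses an orientation. Where \<open>h\<close> vanishes the first case applies,
    which keeps the support in \<open>E\<close>.\<close>
  define \<alpha> :: "real ^ 'n ^ 'n" where
    "\<alpha> = (\<chi> r s. if h' $ r $ s = h $ r $ s then 0 else if f r < f s then pi else - pi)"
  have "\<alpha> $ s $ r = - \<alpha> $ r $ s" for r s
  proof (cases "r = s")
    case False
    then have "f r \<noteq> f s" using f by (simp add: inj_eq)
    then show ?thesis using h's[of r s] Symm_sym[OF h, of r s] by (auto simp: \<alpha>_def)
  qed (simp add: \<alpha>_def diag)
  moreover have "supported E \<alpha>"
    unfolding supported_def
  proof (intro allI impI)
    fix r s assume "r \<noteq> s" "\<alpha> $ r $ s \<noteq> 0"
    then have "h' $ r $ s \<noteq> h $ r $ s" by (auto simp: \<alpha>_def)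
    then have "h $ r $ s \<noteq> 0" using pm[of r s] by auto
    then show "(r, s) \<in> E" using h \<open>r \<noteq> s\<close> unfolding Symm_def supported_def by blast
  qed
  ultimately have "\<alpha> \<in> Asym E" unfolding Asym_iff by blast
  moreover have "magnetic h \<alpha> $ r $ s = cmat h' $ r $ s" for r s
    using pm[of r s] by (auto simp: magnetic_def cmat_def \<alpha>_def exp_minus)
  then have "magnetic h \<alpha> = cmat h'" by (simp add: vec_eq_iff)
  ultimately show ?thesis by (rule that)
qed

lemma principal_submatrix_UNIV [simp]: "principal_submatrix UNIV h = h"
  by (simp add: principal_submatrix_def vec_eq_iff)

text \<open>Simplicity is demanded of every representative of the class; gauge invariance of the
  characteristic polynomial carries it over from the real one, where it is genericity with
  \<open>J = UNIV\<close>.\<close>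

lemma signing_class_critical:
  fixes h :: "real ^ 'n::finite ^ 'n"
  assumes h: "h \<in> Symm E" "generic E h" and h': "signing h h'" and k: "k \<in> {1..CARD('n)}"
  shows "simple_critical_point E h k (gauge_class E (cmat h'))"
proof -
  obtain \<alpha> where \<alpha>: "\<alpha> \<in> Asym E" "magnetic h \<alpha> = cmat h'"
    using signing_magnetic[OF h(1) h'] .
  have simple: "order \<mu> (charpoly (cmat h')) = 1" if "poly (charpoly (cmat h')) \<mu> = 0" for \<mu>
    using h(2) h' that principal_submatrix_UNIV
    unfolding generic_def eigenvalue_on_def simple_eigenvalue_on_def by metis
  have "transpose (cmat h') = cmat h'"
    using h' unfolding signing_def by (simp add: cmat_def transpose_def vec_eq_iff)
  then have "((\<lambda>\<beta>. lam_class k (gauge_class E (magnetic h \<beta>))) has_derivative (\<lambda>_. 0)) (at \<alpha> within Asym E)"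
    using simple by (intro magnetic_real_critical[OF h(1) \<alpha>(1) _ _ k]) (simp_all add: \<alpha>(2))
  then have "critical_point E h (lam_class k) (gauge_class E (cmat h'))"
    unfolding critical_point_def using \<alpha> by metis
  moreover have "simple_eigenvalue_on UNIV A (of_real (lam k A))" if "A \<in> gauge_class E (cmat h')" for A
  proof -
    have "charpoly A = charpoly (cmat h')"
      using that charpoly_gauge_equiv unfolding gauge_class_def by blast
    moreover from this have "lam k A = lam k (cmat h')" by (simp add: lam_def)
    moreover have "poly (charpoly (cmat h')) (of_real (lam k (cmat h'))) = 0"
      using hermitian_lam_root[OF hermitian_magnetic[OF h(1) \<alpha>(1)] k] by (simp add: \<alpha>(2))
    ultimately show ?thesis
      unfolding simple_eigenvalue_on_def using simple by metis
  qed
  ultimately show ?thesis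
    unfolding simple_critical_point_def by blast
qed

lemma simple_critical_point_signing:
  fixes E :: "'n::finite rel" and h :: "real ^ 'n ^ 'n"
  assumes E: "simple_graph E" "connected_graph E" "disjoint_cycles E"
    and h: "h \<in> Symm E" "generic E h" and k: "k \<in> {1..CARD('n)}"
    and crit: "simple_critical_point E h k c"
  obtains h' where "signing h h'" "c = gauge_class E (cmat h')"
proof -
  obtain \<alpha> where \<alpha>: "\<alpha> \<in> Asym E" "c = gauge_class E (magnetic h \<alpha>)"
    and der: "((\<lambda>\<beta>. lam_class k (gauge_class E (magnetic h \<beta>))) has_derivative (\<lambda>_. 0)) (at \<alpha> within Asym E)"
    using crit unfolding simple_critical_point_def critical_point_def by blast
  let ?A = "magnetic h \<alpha>"
  have Herm: "?A \<in> Herm E" by (rule magnetic_in_Herm[OF h(1) \<alpha>(1)])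
  have simple: "order (of_real (lam k ?A)) (charpoly ?A) = 1"
    using crit mem_gauge_class[OF Herm] \<alpha>(2) unfolding simple_critical_point_def simple_eigenvalue_on_def by blast
  have der': "((\<lambda>\<beta>. lam k (magnetic h \<beta>)) has_derivative (\<lambda>_. 0)) (at \<alpha> within Asym E)"
    by (rule has_derivative_transform[OF \<alpha>(1) _ der])
       (rule lam_class_gauge_class[OF magnetic_in_Herm[OF h(1)], symmetric])
  have herm: "hermitian ?A" by (rule hermitian_magnetic[OF h(1) \<alpha>(1)])
  obtain \<psi> where \<psi>: "\<psi> \<noteq> 0" "\<And>r. (\<Sum>s\<in>UNIV. ?A $ r $ s * \<psi> $ s) = of_real (lam k ?A) * \<psi> $ r"
    using charpoly_root_eigenvector[OF hermitian_lam_root[OF herm k]] by metis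
  have Im: "Im (cnj (\<psi> $ r) * ?A $ r $ s * \<psi> $ s) = 0" for r s
    by (rule critical_real_current[OF h(1) \<alpha>(1) k der' simple \<psi>])
  have mod: "cmod (?A $ r $ s) = \<bar>h $ r $ s\<bar>" for r s
    by (simp add: magnetic_def norm_mult)
  have diag: "?A $ r $ r = of_real (h $ r $ r)" for r
    using Asym_antisym[OF \<alpha>(1), of r r] by (simp add: magnetic_def)
  have nz: "\<psi> $ r \<noteq> 0" for r
    by (rule generic_critical_eigenvector_nonzero[OF E h herm mod diag \<psi> Im])
  define h' where "h' = (\<chi> r s. Re (cnj (sgn (\<psi> $ r)) * ?A $ r $ s * sgn (\<psi> $ s)))"
  have e: "complex_of_real (h' $ r $ s) = cnj (sgn (\<psi> $ r)) * ?A $ r $ s * sgn (\<psi> $ s)" for r s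
    unfolding h'_def by (rule gauge_real_signing(1)[OF herm mod diag Im])
  have "signing (principal_submatrix {r. \<psi> $ r \<noteq> 0} h) h'"
    unfolding h'_def by (rule gauge_real_signing(2)[OF herm mod diag Im])
  \<comment> \<open>Since \<open>\<psi>\<close> vanishes nowhere, its support is the whole vertex
    set and the principal submatrix is \<open>h\<close> itself.\<close>
  then have "signing h h'" by (simp add: nz)
  moreover have "gauge_equiv ?A (cmat h')"
    unfolding gauge_equiv_iff
  proof (intro exI allI)
    fix r s
    \<comment> \<open>For nonzero \<open>\<psi> $ r\<close> the value of \<open>sgn\<close> is a
      genuine phase, so the gauge is given by the negative arguments of
      \<open>\<psi>\<close>.\<close>
    have arg: "sgn (\<psi> $ r) = exp (\<i> * of_real (Arg (\<psi> $ r)))" for r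
      using nz[of r] cis_Arg[of "\<psi> $ r"] by (simp add: cis_conv_exp)
    have "cnj (sgn (\<psi> $ r)) = exp (- (\<i> * of_real (Arg (\<psi> $ r))))" for r
      unfolding arg by (simp add: exp_cnj)
    with arg show "cmat h' $ r $ s = exp (\<i> * of_real ((\<chi> r. - Arg (\<psi> $ r)) $ r)) * ?A $ r $ s *
        exp (- (\<i> * of_real ((\<chi> r. - Arg (\<psi> $ r)) $ s)))"
      unfolding cmat_def vec_lambda_beta e by simp
  qed
  then have "c = gauge_class E (cmat h')"
    using gauge_class_eq \<alpha>(2) by blast
  ultimately show ?thesis by (rule that)
qed

theorem corollary3p6:
  fixes E :: "'n::finite rel" and h :: "real ^ 'n ^ 'n"
  assumes "simple_graph E"
    and "connected_graph E"
    and "disjoint_cycles E"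
    and "h \<in> Symm E"
    and "generic E h"
  shows "\<forall>k\<in>{1..CARD('n)}. {c \<in> magnetic_torus E h. simple_critical_point E h k c} = signing_classes E h"
proof (intro ballI set_eqI iffI)
  fix k c
  assume k: "k \<in> {1..CARD('n)}"
  {
    assume "c \<in> {c \<in> magnetic_torus E h. simple_critical_point E h k c}"
    then show "c \<in> signing_classes E h"
      using simple_critical_point_signing[OF assms k] unfolding signing_classes_def by blast
  next
    assume "c \<in> signing_classes E h"
    then show "c \<in> {c \<in> magnetic_torus E h. simple_critical_point E h k c}"
      using signing_class_critical[OF assms(4,5) _ k] unfolding signing_classes_def by blast
  }
qed

end
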